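(* There is an equivalence between permutads $\mathcal{P}$ and shuffle algebras $A$. It is given by $\mathcal{P}_{n+1}=A_n$ for $n\ge0$ (with $\mathrm{id}\in\mathcal{P}_1$ corresponding to $1\in A_0$) and by identifying the partial operation $\circ_t$ with $\bullet_{\sigma_t}$ for every surjective map $t$ with target $\underline{2}$, that is, $\mu\circ_t\nu=\nu\bullet_{\sigma_t}\mu$ for $t:\underline{m+n}\to\underline{2}$, $n=\#t^{-1}(1)$, $\mu\in\mathcal{P}_{m+1}=A_m$, $\nu\in\mathcal{P}_{n+1}=A_n$.
   Context: $\mathbb{K}$ is a commutative ring; $\underline{n}=\{1,\dots,n\}$; $\mathbb{S}_n$ is the symmetric group with identity $1_n$. $\mathrm{Sur}(\underline{n},\underline{k})$ is the set of surjections $\underline{n}\to\underline{k}$; the unique element of $\mathrm{Sur}(\underline{n},\underline{1})$ is the corolla $c_{n+1}$. Substitution: for $t\in\mathrm{Sur}(\underline{n},\underline{k})$ and $t_j\in\mathrm{Sur}(\underline{i_j},\underline{m_j})$ with $i_j=\#t^{-1}(j)$, $(t;t_1,\dots,t_k):\underline{n}\to\underline{m_1+\cdots+m_k}$ is the surjection with $(t;t_1,\dots,t_k)(a)=m_1+\cdots+m_{j-1}+t_j(b)$ whenever $t(a)=j$ and $a$ is the $b$-th element of $t^{-1}(j)$ in increasing order. A permutad is an arity-graded module $\mathcal{P}=\{\mathcal{P}_n\}_{n\ge1}$ of $\mathbb{K}$-modules with $\mathcal{P}_1=\mathbb{K}\,\mathrm{id}$ together with, for each surjection $t:\underline{n}\to\underline{k}$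 ($1\le k\le n$), a linear map $\Gamma(t;-,\dots,-):\bigotimes_{j=1}^k\mathcal{P}_{\#t^{-1}(j)+1}\to\mathcal{P}_{n+1}$, such that $\Gamma(c_{n+1};\mu)=\mu$ and $$\Gamma\big((t;t_1,\dots,t_k);\lambda^1_1,\dots,\lambda^1_{m_1},\dots,\lambda^k_{m_k}\big)=\Gamma\big(t;\Gamma(t_1;\lambda^1_1,\dots,\lambda^1_{m_1}),\dots,\Gamma(t_k;\lambda^k_1,\dots,\lambda^k_{m_k})\big).$$ Its partial operations are $\circ_t:\mathcal{P}_{m+1}\otimes\mathcal{P}_{n+1}\to\mathcal{P}_{m+n+1}$, $\mu\circ_t\nu=\Gamma(t;\nu,\mu)$, for $t:\underline{m+n}\to\underline{2}$ surjective with $n=\#t^{-1}(1)$. An $(i_1,\dots,i_k)$-shuffle is a permutation $\sigma\in\mathbb{S}_{i_1+\cdots+i_k}$ that is increasing on each of the consecutive blocks of sizes $i_1,\dots,i_k$; $\mathrm{Sh}(i_1,\dots,i_k)$ is the set of these. To a surjection $t:\underline{n}\to\underline{k}$ with $t^{-1}(j)=\{l^j_1<\cdots<l^j_{i_j}\}$ one associates the shuffle $\sigma_t\in\mathrm{Sh}(i_1,\dots,i_k)$ with $(\sigma_t(1),\dots,\sigma_t(n))=(l^1_1,\dots,l^1_{i_1},l^2_1,\dots,l^k_{i_k})$. For $\sigma\in\mathbb{S}_n,\tau\in\mathbb{S}_m$, $\sigma\times\tau\in\mathbb{S}_{n+m}$ is the concatenation ($\sigma$ on the first $n$ letters, $\tau$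 shifted by $n$ on the last $m$). A shuffle algebra is a graded $\mathbb{K}$-module $A=\bigoplus_{n\ge0}A_n$ with $A_0=\mathbb{K}\,1$, endowed with bilinear operations $\bullet_\gamma:A_n\otimes A_m\to A_{n+m}$ for $\gamma\in\mathrm{Sh}(n,m)$ such that $1$ is a unit on both sides and $$x\bullet_\gamma(y\bullet_\delta z)=(x\bullet_\sigma y)\bullet_\lambda z\quad (x\in A_n,\ y\in A_m,\ z\in A_r)$$ whenever $\gamma\cdot(1_n\times\delta)=\lambda\cdot(\sigma\times1_r)$ in $\mathrm{Sh}(n,m,r)$, where $\gamma\in\mathrm{Sh}(n,m+r)$, $\delta\in\mathrm{Sh}(m,r)$, $\sigma\in\mathrm{Sh}(n,m)$, $\lambda\in\mathrm{Sh}(n+m,r)$ and $\cdot$ is composition of maps, $(\alpha\cdot\beta)(i)=\alpha(\beta(i))$. Morphisms of permutads and of shuffle algebras are the degree-preserving linear maps commuting with all the structure and preserving $\mathrm{id}$, respectively $1$. *)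

theory Defs
  imports "HOL-Algebra.Module" "HOL-Combinatorics.Permutations"
begin

text \<open>
  The set underlined-n is \<open>{1..n}\<close>.  Surjections are extensional functions, so that
  equality of functions is equality of surjections.
\<close>

definition Sur :: "nat \<Rightarrow> nat \<Rightarrow> (nat \<Rightarrow> nat) set" where
  "Sur n k = {t \<in> {1..n} \<rightarrow>\<^sub>E {1..k}. t ` {1..n} = {1..k}}"

definition corolla :: "nat \<Rightarrow> nat \<Rightarrow> nat" where
  "corolla n = (\<lambda>a\<in>{1..n}. 1)"

definition fibre :: "nat \<Rightarrow> (nat \<Rightarrow> nat) \<Rightarrow> nat \<Rightarrow> nat set" where
  "fibre n t j = {a \<in> {1..n}. t a = j}"

text \<open>
  The substitution \<open>(t; t\<^sub>1, \<dots>, t\<^sub>k)\<close>, where \<open>ts j\<close> is a surjection onto \<open>{1..m j}\<close>.  The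
  cardinality is the position of \<open>a\<close> in its fibre, counted from 1.
\<close>

definition subst_sur ::
    "nat \<Rightarrow> (nat \<Rightarrow> nat) \<Rightarrow> (nat \<Rightarrow> nat) \<Rightarrow> (nat \<Rightarrow> nat \<Rightarrow> nat) \<Rightarrow> nat \<Rightarrow> nat" where
  "subst_sur n t m ts =
     (\<lambda>a\<in>{1..n}. (\<Sum>j\<in>{1..<t a}. m j) + ts (t a) (card {b \<in> fibre n t (t a). b \<le> a}))"

definition Sh :: "nat list \<Rightarrow> (nat \<Rightarrow> nat) set" where
  "Sh is = {\<sigma>. \<sigma> permutes {1..sum_list is} \<and>
     (\<forall>j<length is. strict_mono_on {sum_list (take j is) + 1..sum_list (take (Suc j) is)} \<sigma>)}"

text \<open>
  The shuffle \<open>\<sigma>\<^sub>t\<close>, extended by the identity outside \<open>{1..n}\<close> as \<open>permutes\<close> requires; its word of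
  values on \<open>{1..n}\<close> is the list below, which is indexed from 0.
\<close>

definition shuffle_of :: "nat \<Rightarrow> nat \<Rightarrow> (nat \<Rightarrow> nat) \<Rightarrow> nat \<Rightarrow> nat" where
  "shuffle_of n k t i =
     (if i \<in> {1..n}
      then concat (map (\<lambda>j. sorted_list_of_set (fibre n t j)) [1..<Suc k]) ! (i - 1)
      else i)"

definition perm_times :: "nat \<Rightarrow> nat \<Rightarrow> (nat \<Rightarrow> nat) \<Rightarrow> (nat \<Rightarrow> nat) \<Rightarrow> nat \<Rightarrow> nat" where
  "perm_times n m \<sigma> \<tau> i =
     (if i \<le> n then \<sigma> i else if i \<le> n + m then n + \<tau> (i - n) else i)"

definition linear_map ::
    "('k, 'r) ring_scheme \<Rightarrow> ('k, 'a, 'x) module_scheme \<Rightarrow> ('k, 'b, 'y) module_scheme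
      \<Rightarrow> ('a \<Rightarrow> 'b) \<Rightarrow> bool" where
  "linear_map K M N f \<longleftrightarrow>
     f \<in> carrier M \<rightarrow> carrier N \<and>
     (\<forall>x\<in>carrier M. \<forall>y\<in>carrier M. f (x \<oplus>\<^bsub>M\<^esub> y) = f x \<oplus>\<^bsub>N\<^esub> f y) \<and>
     (\<forall>c\<in>carrier K. \<forall>x\<in>carrier M. f (c \<odot>\<^bsub>M\<^esub> x) = c \<odot>\<^bsub>N\<^esub> f x)"

definition tuples :: "('k, 'a, 'x) module_scheme list \<Rightarrow> 'a list set" where
  "tuples Ms = {xs. list_all2 (\<lambda>x M. x \<in> carrier M) xs Ms}"

text \<open>
  A linear map out of \<open>M\<^sub>1 \<otimes> \<dots> \<otimes> M\<^sub>k\<close> is given by a map on tuples that is linear in each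
  entry.
\<close>

definition multilinear_map ::
    "('k, 'r) ring_scheme \<Rightarrow> ('k, 'a, 'x) module_scheme list \<Rightarrow> ('k, 'b, 'y) module_scheme
      \<Rightarrow> ('a list \<Rightarrow> 'b) \<Rightarrow> bool" where
  "multilinear_map K Ms N f \<longleftrightarrow>
     f \<in> tuples Ms \<rightarrow> carrier N \<and>
     (\<forall>xs\<in>tuples Ms. \<forall>i<length Ms. linear_map K (Ms ! i) N (\<lambda>x. f (xs[i := x])))"

definition bilinear_map ::
    "('k, 'r) ring_scheme \<Rightarrow> ('k, 'a, 'x) module_scheme \<Rightarrow> ('k, 'b, 'y) module_scheme
      \<Rightarrow> ('k, 'c, 'z) module_scheme \<Rightarrow> ('a \<Rightarrow> 'b \<Rightarrow> 'c) \<Rightarrow> bool" where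
  "bilinear_map K M N L f \<longleftrightarrow>
     (\<forall>y\<in>carrier N. linear_map K M L (\<lambda>x. f x y)) \<and>
     (\<forall>x\<in>carrier M. linear_map K N L (\<lambda>y. f x y))"

text \<open>
  \<open>pcomp P n\<close> is the component of arity \<open>n\<close>; only \<open>n \<ge> 1\<close> is meaningful.
  \<open>pgamma P n k t [\<lambda>\<^sub>1, \<dots>, \<lambda>\<^sub>k]\<close> is \<open>\<Gamma>(t; \<lambda>\<^sub>1, \<dots>, \<lambda>\<^sub>k)\<close> for \<open>t \<in> Sur n k\<close>.
\<close>

record ('k, 'a) permutad_data =
  pcomp :: "nat \<Rightarrow> ('k, 'a) module"
  pid :: 'a
  pgamma :: "nat \<Rightarrow> nat \<Rightarrow> (nat \<Rightarrow> nat) \<Rightarrow> 'a list \<Rightarrow> 'a"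

definition input_arities :: "nat \<Rightarrow> nat \<Rightarrow> (nat \<Rightarrow> nat) \<Rightarrow> nat list" where
  "input_arities n k t = map (\<lambda>j. card (fibre n t j) + 1) [1..<Suc k]"

definition gamma_args ::
    "('k, 'a) permutad_data \<Rightarrow> nat \<Rightarrow> nat \<Rightarrow> (nat \<Rightarrow> nat) \<Rightarrow> 'a list set" where
  "gamma_args P n k t = tuples (map (pcomp P) (input_arities n k t))"

text \<open>
  The component of arity 1 is free of rank one on the identity.  In the associativity axiom
  \<open>ls j\<close> is the list of the \<open>m j\<close> arguments of \<open>\<Gamma>(t\<^sub>j; \<dots>)\<close>.
\<close>

locale permutad = cring K
  for K :: "('k, 'r) ring_scheme" (structure)
  and P :: "('k, 'a) permutad_data" +
  assumes comp_module: "n \<ge> 1 \<Longrightarrow> module K (pcomp P n)"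
    and id_closed: "pid P \<in> carrier (pcomp P 1)"
    and id_basis: "bij_betw (\<lambda>c. c \<odot>\<^bsub>pcomp P 1\<^esub> pid P) (carrier K) (carrier (pcomp P 1))"
    and gamma_multilinear:
      "\<lbrakk>1 \<le> k; k \<le> n; t \<in> Sur n k\<rbrakk> \<Longrightarrow>
        multilinear_map K (map (pcomp P) (input_arities n k t)) (pcomp P (n + 1)) (pgamma P n k t)"
    and gamma_corolla:
      "\<lbrakk>1 \<le> n; \<mu> \<in> carrier (pcomp P (n + 1))\<rbrakk> \<Longrightarrow> pgamma P n 1 (corolla n) [\<mu>] = \<mu>"
    and gamma_assoc:
      "\<lbrakk>1 \<le> k; k \<le> n; t \<in> Sur n k;
        \<And>j. j \<in> {1..k} \<Longrightarrow> ts j \<in> Sur (card (fibre n t j)) (m j);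
        \<And>j. j \<in> {1..k} \<Longrightarrow> ls j \<in> gamma_args P (card (fibre n t j)) (m j) (ts j)\<rbrakk> \<Longrightarrow>
        pgamma P n (\<Sum>j\<in>{1..k}. m j) (subst_sur n t m ts) (concat (map ls [1..<Suc k])) =
        pgamma P n k t
          (map (\<lambda>j. pgamma P (card (fibre n t j)) (m j) (ts j) (ls j)) [1..<Suc k])"

text \<open>
  \<open>\<mu> \<circ>\<^sub>t \<nu>\<close> for \<open>t \<in> Sur (m + n) 2\<close> whose fibre over 1 has \<open>n\<close> elements: \<open>\<nu>\<close> belongs to
  the value 1 and \<open>\<mu>\<close> to the value 2, so the arguments are swapped.
\<close>

definition partial_op ::
    "('k, 'a) permutad_data \<Rightarrow> nat \<Rightarrow> nat \<Rightarrow> (nat \<Rightarrow> nat) \<Rightarrow> 'a \<Rightarrow> 'a \<Rightarrow> 'a" where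
  "partial_op P m n t \<mu> \<nu> = pgamma P (m + n) 2 t [\<nu>, \<mu>]"

text \<open>
  Morphisms are families indexed by the arity, made extensional in the arity and on each
  carrier, so that equality of functions is equality of morphisms.
\<close>

definition permutad_hom ::
    "('k, 'r) ring_scheme \<Rightarrow> ('k, 'a) permutad_data \<Rightarrow> ('k, 'a) permutad_data
      \<Rightarrow> (nat \<Rightarrow> 'a \<Rightarrow> 'a) set" where
  "permutad_hom K P Q = {f \<in> extensional {1..}.
     (\<forall>n\<ge>1. f n \<in> extensional (carrier (pcomp P n)) \<and>
            linear_map K (pcomp P n) (pcomp Q n) (f n)) \<and>
     f 1 (pid P) = pid Q \<and>
     (\<forall>n k t. 1 \<le> k \<longrightarrow> k \<le> n \<longrightarrow> t \<in> Sur n k \<longrightarrow>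
        (\<forall>ls\<in>gamma_args P n k t.
           f (n + 1) (pgamma P n k t ls) = pgamma Q n k t (map2 f (input_arities n k t) ls)))}"

text \<open>
  The graded module \<open>\<Oplus>\<^sub>n A\<^sub>n\<close> is given by its homogeneous components \<open>scomp A n\<close>, and
  \<open>sprod A n m \<gamma>\<close> is the operation on \<open>A\<^sub>n \<times> A\<^sub>m\<close> indexed by \<open>\<gamma> \<in> Sh(n, m)\<close>.
\<close>

record ('k, 'a) shuffle_algebra_data =
  scomp :: "nat \<Rightarrow> ('k, 'a) module"
  sone :: 'a
  sprod :: "nat \<Rightarrow> nat \<Rightarrow> (nat \<Rightarrow> nat) \<Rightarrow> 'a \<Rightarrow> 'a \<Rightarrow> 'a"

locale shuffle_algebra = cring K
  for K :: "('k, 'r) ring_scheme" (structure)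
  and A :: "('k, 'a) shuffle_algebra_data" +
  assumes comp_module: "module K (scomp A n)"
    and one_closed: "sone A \<in> carrier (scomp A 0)"
    and one_basis: "bij_betw (\<lambda>c. c \<odot>\<^bsub>scomp A 0\<^esub> sone A) (carrier K) (carrier (scomp A 0))"
    and prod_bilinear:
      "\<gamma> \<in> Sh [n, m] \<Longrightarrow>
        bilinear_map K (scomp A n) (scomp A m) (scomp A (n + m)) (sprod A n m \<gamma>)"
    and one_left:
      "\<lbrakk>\<gamma> \<in> Sh [0, n]; x \<in> carrier (scomp A n)\<rbrakk> \<Longrightarrow> sprod A 0 n \<gamma> (sone A) x = x"
    and one_right:
      "\<lbrakk>\<gamma> \<in> Sh [n, 0]; x \<in> carrier (scomp A n)\<rbrakk> \<Longrightarrow> sprod A n 0 \<gamma> x (sone A) = x"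
    and prod_assoc:
      "\<lbrakk>\<gamma> \<in> Sh [n, m + r]; \<delta> \<in> Sh [m, r]; \<sigma> \<in> Sh [n, m]; \<rho> \<in> Sh [n + m, r];
        \<gamma> \<circ> perm_times n (m + r) id \<delta> = \<rho> \<circ> perm_times (n + m) r \<sigma> id;
        x \<in> carrier (scomp A n); y \<in> carrier (scomp A m); z \<in> carrier (scomp A r)\<rbrakk> \<Longrightarrow>
        sprod A n (m + r) \<gamma> x (sprod A m r \<delta> y z) =
        sprod A (n + m) r \<rho> (sprod A n m \<sigma> x y) z"

definition shuffle_algebra_hom ::
    "('k, 'r) ring_scheme \<Rightarrow> ('k, 'a) shuffle_algebra_data \<Rightarrow> ('k, 'a) shuffle_algebra_data
      \<Rightarrow> (nat \<Rightarrow> 'a \<Rightarrow> 'a) set" where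
  "shuffle_algebra_hom K A B = {f.
     (\<forall>n. f n \<in> extensional (carrier (scomp A n)) \<and>
          linear_map K (scomp A n) (scomp B n) (f n)) \<and>
     f 0 (sone A) = sone B \<and>
     (\<forall>n m \<gamma>. \<gamma> \<in> Sh [n, m] \<longrightarrow>
        (\<forall>x\<in>carrier (scomp A n). \<forall>y\<in>carrier (scomp A m).
           f (n + m) (sprod A n m \<gamma> x y) = sprod B n m \<gamma> (f n x) (f m y)))}"

text \<open>
  \<open>cat_comp C X Y Z g f\<close> is the composite of \<open>f : X \<rightarrow> Y\<close> and \<open>g : Y \<rightarrow> Z\<close>.  The objects are
  arguments because the hom-sets need not be disjoint.
\<close>

record ('o, 'm) cat_data =
  cat_ob :: "'o set"
  cat_hom :: "'o \<Rightarrow> 'o \<Rightarrow> 'm set"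
  cat_comp :: "'o \<Rightarrow> 'o \<Rightarrow> 'o \<Rightarrow> 'm \<Rightarrow> 'm \<Rightarrow> 'm"
  cat_id :: "'o \<Rightarrow> 'm"

locale category =
  fixes C :: "('o, 'm) cat_data"
  assumes id_in_hom: "X \<in> cat_ob C \<Longrightarrow> cat_id C X \<in> cat_hom C X X"
    and comp_in_hom:
      "\<lbrakk>X \<in> cat_ob C; Y \<in> cat_ob C; Z \<in> cat_ob C; f \<in> cat_hom C X Y; g \<in> cat_hom C Y Z\<rbrakk> \<Longrightarrow>
        cat_comp C X Y Z g f \<in> cat_hom C X Z"
    and comp_id_right:
      "\<lbrakk>X \<in> cat_ob C; Y \<in> cat_ob C; f \<in> cat_hom C X Y\<rbrakk> \<Longrightarrow>
        cat_comp C X X Y f (cat_id C X) = f"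
    and comp_id_left:
      "\<lbrakk>X \<in> cat_ob C; Y \<in> cat_ob C; f \<in> cat_hom C X Y\<rbrakk> \<Longrightarrow>
        cat_comp C X Y Y (cat_id C Y) f = f"
    and comp_assoc:
      "\<lbrakk>W \<in> cat_ob C; X \<in> cat_ob C; Y \<in> cat_ob C; Z \<in> cat_ob C;
        f \<in> cat_hom C W X; g \<in> cat_hom C X Y; h \<in> cat_hom C Y Z\<rbrakk> \<Longrightarrow>
        cat_comp C W Y Z h (cat_comp C W X Y g f) = cat_comp C W X Z (cat_comp C X Y Z h g) f"

record ('o, 'm, 'p, 'n) functor_data =
  on_ob :: "'o \<Rightarrow> 'p"
  on_hom :: "'o \<Rightarrow> 'o \<Rightarrow> 'm \<Rightarrow> 'n"

locale cat_functor = C: category C + D: category D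
  for C :: "('o, 'm) cat_data" and D :: "('p, 'n) cat_data"
  and F :: "('o, 'm, 'p, 'n) functor_data" +
  assumes ob: "X \<in> cat_ob C \<Longrightarrow> on_ob F X \<in> cat_ob D"
    and hom:
      "\<lbrakk>X \<in> cat_ob C; Y \<in> cat_ob C; f \<in> cat_hom C X Y\<rbrakk> \<Longrightarrow>
        on_hom F X Y f \<in> cat_hom D (on_ob F X) (on_ob F Y)"
    and id: "X \<in> cat_ob C \<Longrightarrow> on_hom F X X (cat_id C X) = cat_id D (on_ob F X)"
    and comp:
      "\<lbrakk>X \<in> cat_ob C; Y \<in> cat_ob C; Z \<in> cat_ob C; f \<in> cat_hom C X Y; g \<in> cat_hom C Y Z\<rbrakk> \<Longrightarrow>
        on_hom F X Z (cat_comp C X Y Z g f) =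
        cat_comp D (on_ob F X) (on_ob F Y) (on_ob F Z) (on_hom F Y Z g) (on_hom F X Y f)"

definition functor_id :: "('o, 'm, 'o, 'm) functor_data" where
  "functor_id = \<lparr>on_ob = (\<lambda>X. X), on_hom = (\<lambda>X Y f. f)\<rparr>"

definition functor_comp ::
    "('p, 'n, 'q, 'l) functor_data \<Rightarrow> ('o, 'm, 'p, 'n) functor_data
      \<Rightarrow> ('o, 'm, 'q, 'l) functor_data" where
  "functor_comp G F =
     \<lparr>on_ob = (\<lambda>X. on_ob G (on_ob F X)),
      on_hom = (\<lambda>X Y f. on_hom G (on_ob F X) (on_ob F Y) (on_hom F X Y f))\<rparr>"

definition cat_iso :: "('o, 'm) cat_data \<Rightarrow> 'o \<Rightarrow> 'o \<Rightarrow> 'm \<Rightarrow> bool" where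
  "cat_iso C X Y f \<longleftrightarrow> f \<in> cat_hom C X Y \<and>
     (\<exists>g\<in>cat_hom C Y X. cat_comp C X Y X g f = cat_id C X \<and> cat_comp C Y X Y f g = cat_id C Y)"

definition natural_iso ::
    "('o, 'm) cat_data \<Rightarrow> ('p, 'n) cat_data \<Rightarrow> ('o, 'm, 'p, 'n) functor_data
      \<Rightarrow> ('o, 'm, 'p, 'n) functor_data \<Rightarrow> ('o \<Rightarrow> 'n) \<Rightarrow> bool" where
  "natural_iso C D F G \<eta> \<longleftrightarrow>
     (\<forall>X\<in>cat_ob C. cat_iso D (on_ob F X) (on_ob G X) (\<eta> X)) \<and>
     (\<forall>X\<in>cat_ob C. \<forall>Y\<in>cat_ob C. \<forall>f\<in>cat_hom C X Y.
        cat_comp D (on_ob F X) (on_ob F Y) (on_ob G Y) (\<eta> Y) (on_hom F X Y f) =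
        cat_comp D (on_ob F X) (on_ob G X) (on_ob G Y) (on_hom G X Y f) (\<eta> X))"

definition cat_equivalence ::
    "('o, 'm) cat_data \<Rightarrow> ('p, 'n) cat_data \<Rightarrow> ('o, 'm, 'p, 'n) functor_data
      \<Rightarrow> ('p, 'n, 'o, 'm) functor_data \<Rightarrow> bool" where
  "cat_equivalence C D F G \<longleftrightarrow>
     cat_functor C D F \<and> cat_functor D C G \<and>
     (\<exists>\<eta>. natural_iso C C functor_id (functor_comp G F) \<eta>) \<and>
     (\<exists>\<epsilon>. natural_iso D D (functor_comp F G) functor_id \<epsilon>)"

definition permutad_cat ::
    "('k, 'r) ring_scheme \<Rightarrow> (('k, 'a) permutad_data, nat \<Rightarrow> 'a \<Rightarrow> 'a) cat_data" where
  "permutad_cat K =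
     \<lparr>cat_ob = {P. permutad K P},
      cat_hom = permutad_hom K,
      cat_comp = (\<lambda>P Q R g f. \<lambda>n\<in>{1..}. compose (carrier (pcomp P n)) (g n) (f n)),
      cat_id = (\<lambda>P. \<lambda>n\<in>{1..}. \<lambda>x\<in>carrier (pcomp P n). x)\<rparr>"

definition shuffle_algebra_cat ::
    "('k, 'r) ring_scheme \<Rightarrow> (('k, 'a) shuffle_algebra_data, nat \<Rightarrow> 'a \<Rightarrow> 'a) cat_data" where
  "shuffle_algebra_cat K =
     \<lparr>cat_ob = {A. shuffle_algebra K A},
      cat_hom = shuffle_algebra_hom K,
      cat_comp = (\<lambda>A B C g f. \<lambda>n. compose (carrier (scomp A n)) (g n) (f n)),
      cat_id = (\<lambda>A. \<lambda>n. \<lambda>x\<in>carrier (scomp A n). x)\<rparr>"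

text \<open>
  Since \<open>t\<close> is onto \<open>{1..2}\<close>, only \<open>m \<ge> 1\<close> and \<open>n \<ge> 1\<close> occur in the last clause; the products
  in which one factor has degree 0 are determined by bilinearity and the unit.
\<close>

definition identified ::
    "('k, 'a) permutad_data \<Rightarrow> ('k, 'a) shuffle_algebra_data \<Rightarrow> bool" where
  "identified P A \<longleftrightarrow>
     (\<forall>n. pcomp P (n + 1) = scomp A n) \<and>
     pid P = sone A \<and>
     (\<forall>m n t. t \<in> Sur (m + n) 2 \<longrightarrow> n = card (fibre (m + n) t 1) \<longrightarrow>
        (\<forall>\<mu>\<in>carrier (pcomp P (m + 1)). \<forall>\<nu>\<in>carrier (pcomp P (n + 1)).
           partial_op P m n t \<mu> \<nu> = sprod A n m (shuffle_of (m + n) 2 t) \<nu> \<mu>))"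

end

theory Submission
  imports Defs
begin

text \<open>
  Standardisation turns the operations of a shuffle algebra into products \<open>x *\<^bsub>S,T\<^esub> y\<close> indexed by
  disjoint finite sets \<open>S, T\<close> of naturals with \<open>x\<close> of degree \<open>|S|\<close> and \<open>y\<close> of degree \<open>|T|\<close>: the
  shuffle is the one that places \<open>S\<close> and \<open>T\<close> in \<open>S \<union> T\<close>.  In this form the axiom of a shuffle algebra
  is plain associativity, and the products are invariant under increasing relabelling.  Hence a
  list of elements labelled by disjoint sets has a well-defined product, and \<open>\<Gamma>(t; \<lambda>\<^sub>1, \<dots>, \<lambda>\<^sub>k)\<close> is the
  product of the \<open>\<lambda>\<^sub>j\<close> labelled by \<open>t\<^sup>-\<^sup>1(j)\<close>; the permutad axiom is general associativity together with
  relabelling each \<open>t\<^sup>-\<^sup>1(j)\<close> by its ranks.  Conversely, both sides of the shuffle algebra axiom are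
  values of \<open>\<Gamma>\<close> at one surjection onto \<open>{1..3}\<close>.  A surjection onto \<open>{1..k+1}\<close> is the substitution of
  a corolla and a surjection onto \<open>{1..k}\<close> into one onto \<open>{1..2}\<close>, so \<open>\<Gamma>\<close> is determined by its
  partial operations and the two constructions are mutually inverse.
\<close>

section \<open>Ranks and shuffles of finite sets\<close>

text \<open>The obstacle is degree 0. A surjection onto \<open>{1..2}\<close> has two nonempty
  fibres, so no product with a factor of degree 0 is a value of \<Gamma> at such a surjection. These
  products are rebuilt as scalar multiplication through the basis \<open>pid P\<close> of the
  component of arity 1, and bilinearity, associativity, the round trip and the morphisms split into
  cases there. Products indexed by sets need no such split, since a label set may be empty.
  Identifying shuffles costs one comparison of sets: a shuffle of two blocks is fixed by the image
  of its first block, and a surjection onto \<open>{1..2}\<close> by its fibre over 1. The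
  operations are total functions, and after a round trip they are only known to agree with the
  original ones on shuffles, surjections and elements of the carriers. The functors therefore form
  an equivalence rather than a strict isomorphism, and both natural isomorphisms have identity maps
  of the carriers as components.\<close>

definition rank_in :: "nat set \<Rightarrow> nat \<Rightarrow> nat" where
  "rank_in S a = card {b \<in> S. b \<le> a}"

text \<open>Inverse to \<open>rank_in S\<close>, from \<open>{1..card S}\<close> to a finite
  \<open>S\<close>. Ranks count from 1 and list indices from 0, hence the shift.\<close>

definition enum_of :: "nat set \<Rightarrow> nat \<Rightarrow> nat" where
  "enum_of S i = sorted_list_of_set S ! (i - 1)"

lemma strict_mono_on_rank_in:
  assumes "finite S"
  shows "strict_mono_on S (rank_in S)"
proof (rule strict_mono_onI)
  fix a b assume "a \<in> S" "b \<in> S" "a < b"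
  then have "{c \<in> S. c \<le> a} \<subseteq> {c \<in> S. c \<le> b}" "b \<in> {c \<in> S. c \<le> b} - {c \<in> S. c \<le> a}"
    by auto
  then have "{c \<in> S. c \<le> a} \<subset> {c \<in> S. c \<le> b}" by blast
  then show "rank_in S a < rank_in S b"
    unfolding rank_in_def using assms by (intro psubset_card_mono) auto
qed

lemma inj_on_rank_in: "finite S \<Longrightarrow> inj_on (rank_in S) S"
  by (rule strict_mono_on_imp_inj_on[OF strict_mono_on_rank_in])

lemma rank_in_bounds:
  assumes "finite S" "a \<in> S"
  shows "rank_in S a \<in> {1..card S}"
proof -
  have "0 < card {b \<in> S. b \<le> a}" using assms by (subst card_gt_0_iff) auto
  moreover have "card {b \<in> S. b \<le> a} \<le> card S" using assms by (intro card_mono) auto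
  ultimately show ?thesis unfolding rank_in_def by auto
qed

lemma rank_in_image:
  assumes "finite S"
  shows "rank_in S ` S = {1..card S}"
proof (rule card_subset_eq)
  show "rank_in S ` S \<subseteq> {1..card S}" using rank_in_bounds[OF assms] by blast
  show "card (rank_in S ` S) = card {1..card S}" 
    using card_image[OF inj_on_rank_in[OF assms]] by simp
qed simp

text \<open>An increasing map also reflects the order on \<open>S\<close>, so it carries the points
  of \<open>S\<close> below \<open>a\<close> exactly to the points of the image below its value at
  \<open>a\<close>. Every later invariance under relabelling comes from here.\<close>

lemma rank_in_relabel:
  assumes "finite S" "strict_mono_on S \<phi>" "a \<in> S"
  shows "rank_in (\<phi> ` S) (\<phi> a) = rank_in S a"
proof -
  have "{b \<in> \<phi> ` S. b \<le> \<phi> a} = \<phi> ` {b \<in> S. b \<le> a}"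
    using assms by (auto simp: strict_mono_on_less_eq)
  moreover have "inj_on \<phi> {b \<in> S. b \<le> a}"
    using strict_mono_on_imp_inj_on[OF assms(2)] by (rule inj_on_subset) auto
  ultimately show ?thesis unfolding rank_in_def by (simp add: card_image)
qed

lemma rank_in_interval: "a \<in> {1..n} \<Longrightarrow> rank_in {1..n} a = a"
proof -
  assume "a \<in> {1..n}"
  then have "{b \<in> {1..n}. b \<le> a} = {1..a}" by auto
  then show ?thesis by (simp add: rank_in_def)
qed

text \<open>In the common image both values have the rank of \<open>i\<close> in \<open>A\<close>,
  and ranks are injective.\<close>

lemma strict_mono_on_same_image:
  fixes f g :: "nat \<Rightarrow> nat"
  assumes "finite A" "strict_mono_on A f" "strict_mono_on A g" "f ` A = g ` A" "i \<in> A"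
  shows "f i = g i"
proof (rule inj_onD[OF inj_on_rank_in])
  show "rank_in (f ` A) (f i) = rank_in (f ` A) (g i)"
    using rank_in_relabel[OF assms(1,2,5)] rank_in_relabel[OF assms(1,3,5)] assms(4) by simp
qed (use assms in auto)

lemma strict_mono_on_enum_of: "strict_mono_on {1..card S} (enum_of S)"
proof (rule strict_mono_onI)
  fix i j assume "i \<in> {1..card S}" "j \<in> {1..card S}" "i < j"
  then show "enum_of S i < enum_of S j"
    unfolding enum_of_def by (intro sorted_wrt_nth_less[OF strict_sorted_list_of_set]) auto
qed

lemma enum_of_image:
  assumes "finite S"
  shows "enum_of S ` {1..card S} = S"
proof -
  have "enum_of S ` {1..card S} = (!) (sorted_list_of_set S) ` {..<card S}"
    unfolding enum_of_def
    by (force simp: image_iff intro: bexI[of _ "Suc _"])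
  also have "\<dots> = S" 
    using assms nth_image[of "card S" "sorted_list_of_set S"] by (simp add: atLeast0LessThan)
  finally show ?thesis .
qed

lemma enum_of_in: "finite S \<Longrightarrow> i \<in> {1..card S} \<Longrightarrow> enum_of S i \<in> S"
  using enum_of_image by blast

lemma rank_in_enum_of:
  assumes "finite S" "i \<in> {1..card S}"
  shows "rank_in S (enum_of S i) = i"
proof -
  have "rank_in (enum_of S ` {1..card S}) (enum_of S i) = rank_in {1..card S} i"
    by (rule rank_in_relabel) (use assms strict_mono_on_enum_of in auto)
  then show ?thesis using assms by (simp only: enum_of_image rank_in_interval)
qed

lemma enum_of_rank_in:
  assumes "finite S" "a \<in> S"
  shows "enum_of S (rank_in S a) = a"
  by (rule inj_onD[OF inj_on_rank_in[OF assms(1)]])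
    (use rank_in_enum_of enum_of_in rank_in_bounds assms in auto)

section \<open>Shuffles of two blocks\<close>

lemma Sh2_iff:
  "\<gamma> \<in> Sh [n, m] \<longleftrightarrow> \<gamma> permutes {1..n + m} \<and> strict_mono_on {1..n} \<gamma> \<and>
     strict_mono_on {n + 1..n + m} \<gamma>"
  by (auto simp: Sh_def less_Suc_eq)

text \<open>The second block goes to the complement of the image of the first, and on each block an
  increasing map is determined by its image.\<close>

lemma Sh2_eqI:
  assumes "\<gamma> \<in> Sh [n, m]" "\<delta> \<in> Sh [n, m]" "\<gamma> ` {1..n} = \<delta> ` {1..n}"
  shows "\<gamma> = \<delta>"
proof -
  have split: "{1..n + m} = {1..n} \<union> {n + 1..n + m}" by auto
  have rest: "\<epsilon> ` {n + 1..n + m} = {1..n + m} - \<epsilon> ` {1..n}" if "\<epsilon> \<in> Sh [n, m]" for \<epsilon>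
  proof -
    have p: "\<epsilon> permutes {1..n + m}" using that by (simp add: Sh2_iff)
    have "{n + 1..n + m} = {1..n + m} - {1..n}" by auto
    then have "\<epsilon> ` {n + 1..n + m} = \<epsilon> ` {1..n + m} - \<epsilon> ` {1..n}"
      by (simp add: image_set_diff[OF permutes_inj[OF p]])
    then show ?thesis by (simp only: permutes_image[OF p])
  qed
  have "\<gamma> i = \<delta> i" if "i \<in> {1..n}" for i
    using assms that by (intro strict_mono_on_same_image[of "{1..n}"]) (auto simp: Sh2_iff)
  moreover have "\<gamma> i = \<delta> i" if "i \<in> {n + 1..n + m}" for i
    using assms that rest[OF assms(1)] rest[OF assms(2)]
    by (intro strict_mono_on_same_image[of "{n + 1..n + m}"]) (auto simp: Sh2_iff)
  moreover have "\<gamma> i = \<delta> i" if "i \<notin> {1..n + m}" for i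
    using assms that by (metis Sh2_iff permutes_not_in)
  ultimately show ?thesis using split by blast
qed

lemma id_in_Sh2: "id \<in> Sh [n, m]"
  by (simp add: Sh2_iff permutes_id strict_mono_on_def)

lemma Sh2_zero_left: "\<gamma> \<in> Sh [0, m] \<Longrightarrow> \<gamma> = id"
  by (rule Sh2_eqI[OF _ id_in_Sh2]) auto

lemma Sh2_zero_right:
  assumes "\<gamma> \<in> Sh [n, 0]"
  shows "\<gamma> = id"
proof (rule Sh2_eqI[OF assms id_in_Sh2])
  have "\<gamma> permutes {1..n}" using assms by (simp add: Sh2_iff)
  then show "\<gamma> ` {1..n} = id ` {1..n}" by (simp only: permutes_image image_id id_apply)
qed

text \<open>The shuffle that places \<open>S\<close> and \<open>T\<close> in \<open>S \<union> T\<close> (for disjoint \<open>S\<close> and \<open>T\<close>), read on ranks.\<close>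

definition shuffle_sets :: "nat set \<Rightarrow> nat set \<Rightarrow> nat \<Rightarrow> nat" where
  "shuffle_sets S T i =
     (if i \<in> {1..card S} then rank_in (S \<union> T) (enum_of S i)
      else if i \<in> {card S + 1..card S + card T} then rank_in (S \<union> T) (enum_of T (i - card S))
      else i)"

lemma shuffle_sets_image_left:
  assumes "finite S"
  shows "shuffle_sets S T ` {1..card S} = rank_in (S \<union> T) ` S"
proof -
  have "shuffle_sets S T ` {1..card S} = rank_in (S \<union> T) ` enum_of S ` {1..card S}"
    unfolding image_image by (rule image_cong) (auto simp: shuffle_sets_def)
  then show ?thesis by (simp only: enum_of_image[OF assms])
qed

lemma shuffle_sets_image_right:
  assumes "finite T"
  shows "shuffle_sets S T ` {card S + 1..card S + card T} = rank_in (S \<union> T) ` T"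
proof -
  have "shuffle_sets S T ` {card S + 1..card S + card T} =
      (\<lambda>i. rank_in (S \<union> T) (enum_of T (i - card S))) ` {card S + 1..card S + card T}"
    by (rule image_cong) (auto simp: shuffle_sets_def)
  also have "\<dots> = rank_in (S \<union> T) ` enum_of T ` {1..card T}"
  proof -
    have "{card S + 1..card S + card T} = (+) (card S) ` {1..card T}"
      by (simp only: image_add_atLeastAtMost add.commute[of 1] add.commute[of "card T"])
    then show ?thesis by (simp only: image_image add_diff_cancel_left')
  qed
  finally show ?thesis by (simp only: enum_of_image[OF assms])
qed

text \<open>Each block is an increasing enumeration followed by the increasing
  \<open>rank_in (S \<union> T)\<close>. Together the two blocks reach every rank of the
  union.\<close>

lemma shuffle_sets_in_Sh:
  assumes "finite S" "finite T" "S \<inter> T = {}"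
  shows "shuffle_sets S T \<in> Sh [card S, card T]"
proof -
  let ?n = "card S" and ?m = "card T" and ?\<gamma> = "shuffle_sets S T"
  have card: "card (S \<union> T) = ?n + ?m" using assms by (rule card_Un_disjoint)
  have "{1..?n + ?m} = {1..?n} \<union> {?n + 1..?n + ?m}" by auto
  then have "?\<gamma> ` {1..?n + ?m} = rank_in (S \<union> T) ` (S \<union> T)"
    using assms by (simp only: image_Un shuffle_sets_image_left shuffle_sets_image_right)
  then have im: "?\<gamma> ` {1..?n + ?m} = {1..?n + ?m}"
    using assms rank_in_image[of "S \<union> T"] by (simp add: card)
  \<comment> \<open>A map of a finite set onto a set of the same size is injective.\<close>
  then have "inj_on ?\<gamma> {1..?n + ?m}" by (intro eq_card_imp_inj_on) auto
  with im have "?\<gamma> permutes {1..?n + ?m}"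
    by (intro bij_imp_permutes) (auto simp: bij_betw_def shuffle_sets_def)
  moreover have "strict_mono_on {1..?n} ?\<gamma>"
  proof (rule strict_mono_onI)
    fix i j assume ij: "i \<in> {1..?n}" "j \<in> {1..?n}" "i < j"
    then have "enum_of S i < enum_of S j"
      using strict_mono_onD[OF strict_mono_on_enum_of] by blast
    then show "?\<gamma> i < ?\<gamma> j"
      using ij enum_of_in assms strict_mono_onD[OF strict_mono_on_rank_in[of "S \<union> T"]]
      by (auto simp: shuffle_sets_def)
  qed
  moreover have "strict_mono_on {?n + 1..?n + ?m} ?\<gamma>"
  proof (rule strict_mono_onI)
    fix i j assume ij: "i \<in> {?n + 1..?n + ?m}" "j \<in> {?n + 1..?n + ?m}" "i < j"
    then have r: "i - ?n \<in> {1..?m}" "j - ?n \<in> {1..?m}" "i - ?n < j - ?n" by auto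
    then have "enum_of T (i - ?n) < enum_of T (j - ?n)"
      using strict_mono_onD[OF strict_mono_on_enum_of] by blast
    moreover have "enum_of T (i - ?n) \<in> T" "enum_of T (j - ?n) \<in> T"
      using r assms enum_of_in by auto
    ultimately show "?\<gamma> i < ?\<gamma> j"
      using ij assms strict_mono_onD[OF strict_mono_on_rank_in[of "S \<union> T"]]
      by (auto simp: shuffle_sets_def)
  qed
  ultimately show ?thesis by (simp add: Sh2_iff)
qed

lemma shuffle_sets_eqI:
  assumes "finite S" "finite T" "S \<inter> T = {}" "\<gamma> \<in> Sh [card S, card T]"
    and "\<gamma> ` {1..card S} = rank_in (S \<union> T) ` S"
  shows "shuffle_sets S T = \<gamma>"
  by (rule Sh2_eqI[OF shuffle_sets_in_Sh])
    (use assms in \<open>auto simp only: shuffle_sets_image_left\<close>)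

text \<open>Ranks in the union are unchanged, so the first block keeps its image, and that
  determines the shuffle.\<close>

lemma shuffle_sets_relabel:
  assumes "finite S" "finite T" "S \<inter> T = {}" "strict_mono_on (S \<union> T) \<phi>"
  shows "shuffle_sets (\<phi> ` S) (\<phi> ` T) = shuffle_sets S T"
proof -
  have inj: "inj_on \<phi> (S \<union> T)" by (rule strict_mono_on_imp_inj_on[OF assms(4)])
  have card: "card (\<phi> ` S) = card S" "card (\<phi> ` T) = card T"
    using inj by (auto intro!: card_image intro: inj_on_subset)
  have "rank_in (\<phi> ` S \<union> \<phi> ` T) ` \<phi> ` S = rank_in (S \<union> T) ` S"
    unfolding image_image
    by (rule image_cong)
      (use rank_in_relabel[of "S \<union> T" \<phi>] assms in \<open>auto simp: image_Un\<close>)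
  moreover have "\<phi> ` S \<inter> \<phi> ` T = {}"
    using inj assms(3) by (auto simp: inj_on_def)
  ultimately show ?thesis
    using shuffle_sets_in_Sh[OF assms(1-3)] shuffle_sets_image_left[OF assms(1)] assms
    by (intro shuffle_sets_eqI) (simp_all add: card)
qed

text \<open>Ranks in \<open>{1..n + m}\<close> are the points themselves, so standardisation changes
  nothing when the two sets fill this interval. Hence every shuffle comes from a pair of
  sets.\<close>

lemma shuffle_sets_blocks:
  assumes "\<gamma> \<in> Sh [n, m]"
  shows "shuffle_sets (\<gamma> ` {1..n}) (\<gamma> ` {n + 1..n + m}) = \<gamma>"
proof -
  have p: "\<gamma> permutes {1..n + m}" using assms by (simp add: Sh2_iff)
  note inj = permutes_inj[OF p]
  have card: "card (\<gamma> ` {1..n}) = n" "card (\<gamma> ` {n + 1..n + m}) = m"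
    using inj by (subst card_image; auto intro: inj_on_subset)+
  have "{1..n + m} = {1..n} \<union> {n + 1..n + m}" by auto
  then have un: "\<gamma> ` {1..n} \<union> \<gamma> ` {n + 1..n + m} = {1..n + m}"
    using permutes_image[OF p] by (simp only: image_Un)
  have "rank_in {1..n + m} ` \<gamma> ` {1..n} = id ` \<gamma> ` {1..n}"
    by (rule image_cong) (use un rank_in_interval in \<open>auto simp only: id_apply\<close>)
  moreover have "\<gamma> ` {1..n} \<inter> \<gamma> ` {n + 1..n + m} = {}"
    by (simp flip: image_Int[OF inj])
  ultimately show ?thesis
    using assms by (intro shuffle_sets_eqI) (simp_all only: card un, auto)
qed

text \<open>Both composites send a position in the word listing \<open>S\<close>, then
  \<open>T\<close>, then \<open>U\<close> to the rank of its letter in the union of all three; the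
  intermediate \<open>rank_in\<close> cancels against the following \<open>enum_of\<close>.\<close>

lemma shuffle_sets_assoc:
  assumes "finite S" "finite T" "finite U" "S \<inter> T = {}" "S \<inter> U = {}" "T \<inter> U = {}"
  shows "shuffle_sets S (T \<union> U) \<circ> perm_times (card S) (card T + card U) id (shuffle_sets T U) =
    shuffle_sets (S \<union> T) U \<circ> perm_times (card S + card T) (card U) (shuffle_sets S T) id"
    (is "?l = ?r")
proof
  fix i
  have card: "card (S \<union> T) = card S + card T" "card (T \<union> U) = card T + card U"
    using assms by (simp_all add: card_Un_disjoint)
  \<comment> \<open>The middle three cases place \<open>i\<close> in the block of \<open>S\<close>,
    \<open>T\<close> or \<open>U\<close>, with \<open>j\<close> its position inside the block. The
    outer two are points that both sides fix.\<close>
  consider "i = 0" | "i \<in> {1..card S}" | j where "j \<in> {1..card T}" "i = card S + j"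
    | j where "j \<in> {1..card U}" "i = card S + card T + j" | "i > card S + card T + card U"
  proof (cases "i = 0 \<or> i \<in> {1..card S} \<or> i > card S + card T + card U")
    case False
    then have "i - card S \<in> {1..card T} \<and> i = card S + (i - card S) \<or>
        i - (card S + card T) \<in> {1..card U} \<and> i = card S + card T + (i - (card S + card T))"
      by auto
    then show ?thesis using that by blast
  qed (use that in blast)
  then show "?l i = ?r i"
  proof cases
    case 2
    have e: "enum_of S i \<in> S" using 2 assms enum_of_in by blast
    then have "rank_in (S \<union> T) (enum_of S i) \<in> {1..card S + card T}"
      "enum_of (S \<union> T) (rank_in (S \<union> T) (enum_of S i)) = enum_of S i"
      using rank_in_bounds[of "S \<union> T" "enum_of S i"] enum_of_rank_in assms by (auto simp: card)
    then show ?thesis using 2 by (auto simp: perm_times_def shuffle_sets_def card Un_assoc)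
  next
    case 3
    have e: "enum_of T j \<in> T" using 3 assms enum_of_in by blast
    then have "rank_in (S \<union> T) (enum_of T j) \<in> {1..card S + card T}"
      "enum_of (S \<union> T) (rank_in (S \<union> T) (enum_of T j)) = enum_of T j"
      "rank_in (T \<union> U) (enum_of T j) \<in> {1..card T + card U}"
      "enum_of (T \<union> U) (rank_in (T \<union> U) (enum_of T j)) = enum_of T j"
      using rank_in_bounds[of "S \<union> T" "enum_of T j"] rank_in_bounds[of "T \<union> U" "enum_of T j"]
        enum_of_rank_in assms by (auto simp: card)
    then show ?thesis using 3 by (auto simp: perm_times_def shuffle_sets_def card Un_assoc)
  next
    case 4
    have e: "enum_of U j \<in> U" using 4 assms enum_of_in by blast
    then have "rank_in (T \<union> U) (enum_of U j) \<in> {1..card T + card U}"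
      "enum_of (T \<union> U) (rank_in (T \<union> U) (enum_of U j)) = enum_of U j"
      using rank_in_bounds[of "T \<union> U" "enum_of U j"]
        enum_of_rank_in assms by (auto simp: card)
    then show ?thesis using 4 by (auto simp: perm_times_def shuffle_sets_def card Un_assoc)
  qed (auto simp: perm_times_def shuffle_sets_def card)
qed

section \<open>Surjections and their fibres\<close>

lemma SurD:
  assumes "t \<in> Sur n k"
  shows "a \<in> {1..n} \<Longrightarrow> t a \<in> {1..k}" "j \<in> {1..k} \<Longrightarrow> fibre n t j \<noteq> {}"
    "a \<notin> {1..n} \<Longrightarrow> t a = undefined"
proof -
  have "t \<in> {1..n} \<rightarrow>\<^sub>E {1..k}" and im: "t ` {1..n} = {1..k}" using assms by (auto simp: Sur_def)
  then show "a \<in> {1..n} \<Longrightarrow> t a \<in> {1..k}" "a \<notin> {1..n} \<Longrightarrow> t a = undefined"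
    by (blast intro: PiE_mem PiE_arb)+
  assume "j \<in> {1..k}"
  then have "j \<in> t ` {1..n}" by (simp only: im)
  then show "fibre n t j \<noteq> {}" by (auto simp: fibre_def)
qed

lemma SurI:
  assumes "\<And>a. a \<in> {1..n} \<Longrightarrow> t a \<in> {1..k}" "\<And>a. a \<notin> {1..n} \<Longrightarrow> t a = undefined"
    and "\<And>j. j \<in> {1..k} \<Longrightarrow> \<exists>a\<in>{1..n}. t a = j"
  shows "t \<in> Sur n k"
proof -
  have "{1..k} \<subseteq> t ` {1..n}" using assms(3) by (metis imageI subsetI)
  moreover have "t ` {1..n} \<subseteq> {1..k}" using assms(1) by blast
  moreover have "t \<in> {1..n} \<rightarrow>\<^sub>E {1..k}" using assms(1,2) by (intro PiE_I) blast+
  ultimately show ?thesis unfolding Sur_def by blast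
qed

lemma finite_fibre [simp]: "finite (fibre n t j)"
  by (simp add: fibre_def)

lemma fibre_subset: "fibre n t j \<subseteq> {1..n}"
  by (auto simp: fibre_def)

lemma fibre_disjoint: "i \<noteq> j \<Longrightarrow> fibre n t i \<inter> fibre n t j = {}"
  by (auto simp: fibre_def)

lemma card_fibre_pos: "t \<in> Sur n k \<Longrightarrow> j \<in> {1..k} \<Longrightarrow> card (fibre n t j) \<ge> 1"
  using SurD(2) by (metis One_nat_def Suc_leI card_gt_0_iff finite_fibre)

lemma Sur_le:
  assumes "t \<in> Sur n k"
  shows "k \<le> n"
proof -
  have "card (t ` {1..n}) \<le> card {1..n}" by (rule card_image_le) simp
  then show ?thesis using assms by (simp add: Sur_def)
qed

lemma Sur2_fibres:
  assumes "t \<in> Sur n 2"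
  shows "fibre n t 1 \<union> fibre n t 2 = {1..n}" "card (fibre n t 1) + card (fibre n t 2) = n"
proof -
  have "t a = 1 \<or> t a = 2" if "a \<in> {1..n}" for a using SurD(1)[OF assms that] by auto
  then show u: "fibre n t 1 \<union> fibre n t 2 = {1..n}" unfolding fibre_def by blast
  have "card (fibre n t 1 \<union> fibre n t 2) = card (fibre n t 1) + card (fibre n t 2)"
    by (rule card_Un_disjoint) (auto simp: fibre_def)
  then show "card (fibre n t 1) + card (fibre n t 2) = n"
    unfolding u by simp
qed

text \<open>The two fibres fill \<open>{1..n}\<close>, where ranks are the points themselves, so
  standardising them leaves just the word listing one fibre after the other.\<close>

lemma shuffle_of_two:
  assumes "t \<in> Sur n 2"
  shows "shuffle_of n 2 t = shuffle_sets (fibre n t 1) (fibre n t 2)"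
proof
  fix i
  let ?S = "fibre n t 1" and ?T = "fibre n t 2"
  note u = Sur2_fibres[OF assms]
  have l: "concat (map (\<lambda>j. sorted_list_of_set (fibre n t j)) [1..<Suc 2]) =
      sorted_list_of_set ?S @ sorted_list_of_set ?T"
    by (simp add: upt_rec numeral_2_eq_2)
  have r: "rank_in {1..n} (enum_of (fibre n t v) j) = enum_of (fibre n t v) j"
    if "j \<in> {1..card (fibre n t v)}" for v j
    using enum_of_in[OF finite_fibre that] fibre_subset by (intro rank_in_interval) blast
  consider "i \<in> {1..card ?S}" | "i \<in> {card ?S + 1..n}" | "i \<notin> {1..n}" using u(2) by force
  then show "shuffle_of n 2 t i = shuffle_sets ?S ?T i"
  proof cases
    case 1
    then have "i \<in> {1..n}" "i - 1 < card ?S" using u(2) by auto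
    then show ?thesis
      using 1 r[OF 1] unfolding shuffle_of_def l shuffle_sets_def u(1) nth_append
      by (simp only: enum_of_def length_sorted_list_of_set if_True)
  next
    case 2
    then have i: "i \<in> {1..n}" "\<not> i - 1 < card ?S" "i \<notin> {1..card ?S}"
      "i \<in> {card ?S + 1..card ?S + card ?T}" "i - card ?S \<in> {1..card ?T}"
      "i - 1 - card ?S = i - card ?S - 1"
      using u(2) by auto
    then show ?thesis
      using r[OF i(5)] unfolding shuffle_of_def l shuffle_sets_def u(1) nth_append
      by (simp only: enum_of_def length_sorted_list_of_set if_True if_False)
  next
    case 3
    then have "i \<notin> {1..card ?S}" "i \<notin> {card ?S + 1..card ?S + card ?T}" using u(2) by auto
    with 3 show ?thesis unfolding shuffle_of_def shuffle_sets_def by (simp only: if_False)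
  qed
qed

section \<open>From shuffle algebras to permutads\<close>

lemma linear_map_compose:
  assumes "linear_map K M N f" "linear_map K N L g"
  shows "linear_map K M L (\<lambda>x. g (f x))"
  using assms by (auto simp: linear_map_def Pi_iff)

lemma linear_map_cong:
  assumes "linear_map K M N f" "module K M" "\<And>x. x \<in> carrier M \<Longrightarrow> f x = g x"
  shows "linear_map K M N g"
proof -
  interpret module K M by fact
  show ?thesis using assms(1,3) by (auto simp: linear_map_def Pi_iff)
qed

section \<open>Products of elements labelled by disjoint sets\<close>

definition set_prod ::
    "('k, 'a) shuffle_algebra_data \<Rightarrow> nat set \<Rightarrow> nat set \<Rightarrow> 'a \<Rightarrow> 'a \<Rightarrow> 'a" where
  "set_prod A S T = sprod A (card S) (card T) (shuffle_sets S T)"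

definition labels :: "(nat set \<times> 'a) list \<Rightarrow> nat set" where
  "labels ps = \<Union> (set (map fst ps))"

lemma labels_simps [simp]:
  "labels [] = {}" "labels (p # ps) = fst p \<union> labels ps" "labels (ps @ qs) = labels ps \<union> labels qs"
  by (auto simp: labels_def)

text \<open>Bracketed to the right and closed by the unit: the empty list has a value, so
  \<open>labelled_prod_append\<close> covers every splitting, and a single factor is recovered by
  the right unit law.\<close>

fun labelled_prod :: "('k, 'a) shuffle_algebra_data \<Rightarrow> (nat set \<times> 'a) list \<Rightarrow> 'a" where
  "labelled_prod A [] = sone A"
| "labelled_prod A ((S, x) # ps) = set_prod A S (labels ps) x (labelled_prod A ps)"

fun labelled :: "('k, 'a) shuffle_algebra_data \<Rightarrow> (nat set \<times> 'a) list \<Rightarrow> bool" where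
  "labelled A [] \<longleftrightarrow> True"
| "labelled A ((S, x) # ps) \<longleftrightarrow>
     finite S \<and> x \<in> carrier (scomp A (card S)) \<and> S \<inter> labels ps = {} \<and> labelled A ps"

lemma labelled_append:
  "labelled A (ps @ qs) \<longleftrightarrow> labelled A ps \<and> labelled A qs \<and> labels ps \<inter> labels qs = {}"
  by (induction ps) auto

lemma finite_labels: "labelled A ps \<Longrightarrow> finite (labels ps)"
  by (induction ps) auto

lemma labels_concat: "labels (concat pss) = (\<Union>ps\<in>set pss. labels ps)"
  by (induction pss) auto

lemma labelled_concat:
  assumes "distinct js" "\<And>j. j \<in> set js \<Longrightarrow> labelled A (e j)"
    and "\<And>j. j \<in> set js \<Longrightarrow> labels (e j) = fibre n t j"
  shows "labelled A (concat (map e js))"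
  using assms
proof (induction js)
  case (Cons j js)
  then have "labels (concat (map e js)) = (\<Union>i\<in>set js. fibre n t i)"
    by (simp add: labels_concat)
  moreover have "fibre n t j \<inter> (\<Union>i\<in>set js. fibre n t i) = {}"
    using Cons.prems(1) by (auto simp: fibre_def)
  ultimately show ?case using Cons by (simp add: labelled_append)
qed simp

lemma labels_relabel: "labels (map (apfst ((`) \<phi>)) ps) = \<phi> ` labels ps"
  by (induction ps) auto

lemma labelled_relabel:
  assumes "labelled A ps" "inj_on \<phi> (labels ps)"
  shows "labelled A (map (apfst ((`) \<phi>)) ps)"
  using assms
proof (induction ps)
  case (Cons p ps)
  obtain S x where p: "p = (S, x)" by (cases p)
  have inj: "inj_on \<phi> (S \<union> labels ps)" using Cons.prems p by simp
  then have "inj_on \<phi> S" "inj_on \<phi> (labels ps)" by (auto intro: inj_on_subset)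
  moreover have "\<phi> ` S \<inter> \<phi> ` labels ps = {}"
    using inj Cons.prems(1) p inj_on_image_Int[OF inj, of S "labels ps"] by simp
  ultimately show ?case using Cons p by (simp add: labels_relabel card_image)
qed simp

lemma labelled_zip_fibres:
  assumes "list_all2 (\<lambda>x j. x \<in> carrier (scomp A (card (fibre n t j)))) ls js" "distinct js"
  shows "labelled A (zip (map (fibre n t) js) ls) \<and>
    labels (zip (map (fibre n t) js) ls) = (\<Union>j\<in>set js. fibre n t j)"
  using assms
proof (induction rule: list_all2_induct)
  case (Cons x xs j js)
  moreover have "fibre n t j \<inter> (\<Union>i\<in>set js. fibre n t i) = {}"
    using Cons.prems by (auto simp: fibre_def)
  ultimately show ?case by simp
qed simp

lemma Union_fibres:
  assumes "t \<in> Sur n k"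
  shows "(\<Union>j\<in>set [1..<Suc k]. fibre n t j) = {1..n}"
proof -
  have "set [1..<Suc k] = {1..k}" by auto
  then show ?thesis using SurD(1)[OF assms] unfolding fibre_def by blast
qed

context shuffle_algebra
begin

lemma set_prod_bilinear:
  assumes "finite S" "finite T" "S \<inter> T = {}"
  shows "bilinear_map K (scomp A (card S)) (scomp A (card T)) (scomp A (card (S \<union> T)))
    (set_prod A S T)"
  unfolding set_prod_def card_Un_disjoint[OF assms]
  by (rule prod_bilinear[OF shuffle_sets_in_Sh[OF assms]])

lemma set_prod_closed:
  assumes "finite S" "finite T" "S \<inter> T = {}" "x \<in> carrier (scomp A (card S))"
    "y \<in> carrier (scomp A (card T))"
  shows "set_prod A S T x y \<in> carrier (scomp A (card (S \<union> T)))"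
  using set_prod_bilinear[OF assms(1-3)] assms(4,5)
  by (auto simp: bilinear_map_def linear_map_def)

text \<open>The compatibility hypothesis of \<open>prod_assoc\<close> on the four shuffles is
  exactly \<open>shuffle_sets_assoc\<close>.\<close>

lemma set_prod_assoc:
  assumes "finite S" "finite T" "finite U" "S \<inter> T = {}" "S \<inter> U = {}" "T \<inter> U = {}"
    and "x \<in> carrier (scomp A (card S))" "y \<in> carrier (scomp A (card T))"
      "z \<in> carrier (scomp A (card U))"
  shows "set_prod A S (T \<union> U) x (set_prod A T U y z) = set_prod A (S \<union> T) U (set_prod A S T x y) z"
proof -
  have card: "card (S \<union> T) = card S + card T" "card (T \<union> U) = card T + card U"
    using assms by (simp_all add: card_Un_disjoint)
  have "shuffle_sets S (T \<union> U) \<in> Sh [card S, card T + card U]"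
    "shuffle_sets (S \<union> T) U \<in> Sh [card S + card T, card U]"
    using shuffle_sets_in_Sh[of S "T \<union> U"] shuffle_sets_in_Sh[of "S \<union> T" U] assms
    by (auto simp: card)
  then show ?thesis
    unfolding set_prod_def card using assms
    by (intro prod_assoc) (auto intro: shuffle_sets_in_Sh shuffle_sets_assoc)
qed

lemma set_prod_one_left:
  assumes "finite T" "y \<in> carrier (scomp A (card T))"
  shows "set_prod A {} T (sone A) y = y"
  using one_left[of "shuffle_sets {} T" "card T"] shuffle_sets_in_Sh[of "{}" T] assms
  by (simp add: set_prod_def)

lemma set_prod_one_right:
  assumes "finite S" "x \<in> carrier (scomp A (card S))"
  shows "set_prod A S {} x (sone A) = x"
  using one_right[of "shuffle_sets S {}" "card S"] shuffle_sets_in_Sh[of S "{}"] assms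
  by (simp add: set_prod_def)

lemma set_prod_relabel:
  assumes "finite S" "finite T" "S \<inter> T = {}" "strict_mono_on (S \<union> T) \<phi>"
  shows "set_prod A (\<phi> ` S) (\<phi> ` T) = set_prod A S T"
proof -
  have "inj_on \<phi> (S \<union> T)" by (rule strict_mono_on_imp_inj_on[OF assms(4)])
  then have "card (\<phi> ` S) = card S" "card (\<phi> ` T) = card T"
    by (auto intro!: card_image intro: inj_on_subset)
  then show ?thesis by (simp add: set_prod_def shuffle_sets_relabel[OF assms])
qed

lemma labelled_prod_closed:
  "labelled A ps \<Longrightarrow> labelled_prod A ps \<in> carrier (scomp A (card (labels ps)))"
  by (induction ps) (auto simp: one_closed finite_labels[of A] intro!: set_prod_closed)

lemma labelled_prod_single:
  assumes "finite S" "x \<in> carrier (scomp A (card S))"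
  shows "labelled_prod A [(S, x)] = x"
  using set_prod_one_right[OF assms] by simp

text \<open>General associativity, by induction on the first list: moving one factor across is one
  use of \<open>set_prod_assoc\<close>, and the empty list is the left unit law.\<close>

lemma labelled_prod_append:
  assumes "labelled A (ps @ qs)"
  shows "labelled_prod A (ps @ qs) =
    set_prod A (labels ps) (labels qs) (labelled_prod A ps) (labelled_prod A qs)"
  using assms
proof (induction ps)
  case Nil
  then show ?case
    by (simp add: labelled_prod_closed set_prod_one_left finite_labels[of A])
next
  case (Cons p ps)
  obtain S x where p: "p = (S, x)" by (cases p)
  have l: "labelled A ps" "labelled A qs" "labels ps \<inter> labels qs = {}" "S \<inter> labels ps = {}"
    "S \<inter> labels qs = {}" "finite S" "x \<in> carrier (scomp A (card S))"
    using Cons.prems by (auto simp: p labelled_append)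
  then show ?case
    using Cons by (simp add: p finite_labels[of A] labelled_prod_closed set_prod_assoc)
qed

text \<open>Iterating \<open>labelled_prod_append\<close> evaluates the product block by block, each
  block entering with the union of its labels. This is the bracketing on the right of the permutad
  axiom.\<close>

lemma labelled_prod_concat:
  assumes "labelled A (concat pss)"
  shows "labelled_prod A (concat pss) =
    labelled_prod A (map (\<lambda>ps. (labels ps, labelled_prod A ps)) pss)"
  using assms
proof (induction pss)
  case (Cons ps pss)
  have "labels (map (\<lambda>ps. (labels ps, labelled_prod A ps)) pss) = labels (concat pss)"
    by (induction pss) auto
  then show ?case using Cons by (simp add: labelled_prod_append labelled_append)
qed simp

lemma labelled_prod_relabel:
  assumes "labelled A ps" "strict_mono_on (labels ps) \<phi>"
  shows "labelled_prod A (map (apfst ((`) \<phi>)) ps) = labelled_prod A ps"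
  using assms
proof (induction ps)
  case (Cons p ps)
  obtain S x where p: "p = (S, x)" by (cases p)
  have "strict_mono_on (labels ps) \<phi>"
    using Cons.prems(2) by (rule monotone_on_subset) auto
  then show ?case
    using Cons p by (simp add: labels_relabel set_prod_relabel finite_labels[of A])
qed simp

text \<open>While one entry varies, its label stays fixed. The product is then a composite of linear
  maps, one for each level of the recursion.\<close>

lemma labelled_prod_linear:
  assumes "labelled A ps" "i < length ps"
  shows "linear_map K (scomp A (card (fst (ps ! i)))) (scomp A (card (labels ps)))
    (\<lambda>x. labelled_prod A (ps[i := (fst (ps ! i), x)]))"
  using assms
proof (induction ps arbitrary: i)
  case (Cons p ps)
  obtain S x where p: "p = (S, x)" by (cases p)
  have l: "finite S" "x \<in> carrier (scomp A (card S))" "S \<inter> labels ps = {}" "labelled A ps"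
    "finite (labels ps)"
    using Cons.prems by (auto simp: p finite_labels)
  note bil = set_prod_bilinear[OF l(1) l(5) l(3)]
  show ?case
  proof (cases i)
    case 0
    then show ?thesis using bil labelled_prod_closed[OF l(4)] by (simp add: p bilinear_map_def)
  next
    case (Suc i')
    have i': "i' < length ps" using Cons.prems Suc by simp
    \<comment> \<open>The label set of the tail, and with it the shuffle of the outer product, must
      not depend on \<open>y\<close>.\<close>
    have "map fst (ps[i' := (fst (ps ! i'), y)]) = map fst ps" for y
      using i' list_update_id[of "map fst ps" i'] by (simp add: map_update del: list_update_id)
    then have "labels (ps[i' := (fst (ps ! i'), y)]) = labels ps" for y
      by (simp only: labels_def)
    then have "(\<lambda>y. labelled_prod A ((p # ps)[i := (fst ((p # ps) ! i), y)])) =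
        (\<lambda>y. set_prod A S (labels ps) x (labelled_prod A (ps[i' := (fst (ps ! i'), y)])))"
      by (simp add: p Suc)
    moreover have "linear_map K (scomp A (card (fst (ps ! i')))) (scomp A (card (S \<union> labels ps)))
        (\<lambda>y. set_prod A S (labels ps) x (labelled_prod A (ps[i' := (fst (ps ! i'), y)])))"
    proof (rule linear_map_compose[where g = "set_prod A S (labels ps) x"])
      show "linear_map K (scomp A (card (fst (ps ! i')))) (scomp A (card (labels ps)))
          (\<lambda>y. labelled_prod A (ps[i' := (fst (ps ! i'), y)]))"
        by (rule Cons.IH[OF l(4)]) (rule i')
      show "linear_map K (scomp A (card (labels ps))) (scomp A (card (S \<union> labels ps)))
          (set_prod A S (labels ps) x)"
        using bil l(2) by (simp add: bilinear_map_def)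
    qed
    ultimately show ?thesis by (simp add: p Suc)
  qed
qed simp

end

text \<open>Arity exceeds degree by one. At arity 0, truncated subtraction gives
  \<open>scomp A 0\<close> as a default value.\<close>

definition permutad_of :: "('k, 'a) shuffle_algebra_data \<Rightarrow> ('k, 'a) permutad_data" where
  "permutad_of A =
     \<lparr>pcomp = (\<lambda>n. scomp A (n - 1)), pid = sone A,
      pgamma = (\<lambda>n k t ls. labelled_prod A (zip (map (fibre n t) [1..<Suc k]) ls))\<rparr>"

lemma permutad_of_simps [simp]:
  "pcomp (permutad_of A) = (\<lambda>n. scomp A (n - 1))" "pid (permutad_of A) = sone A"
  "pgamma (permutad_of A) n k t ls = labelled_prod A (zip (map (fibre n t) [1..<Suc k]) ls)"
  by (simp_all add: permutad_of_def)

section \<open>Arguments of \<Gamma> and the fibres of a substitution\<close>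

lemma gamma_args_iff:
  "ls \<in> gamma_args P n k t \<longleftrightarrow>
     list_all2 (\<lambda>x j. x \<in> carrier (pcomp P (card (fibre n t j) + 1))) ls [1..<Suc k]"
  by (simp add: gamma_args_def tuples_def input_arities_def list_all2_map2 del: upt_Suc)

lemma gamma_args_length: "ls \<in> gamma_args P n k t \<Longrightarrow> length ls = k"
  using list_all2_lengthD by (fastforce simp: gamma_args_iff simp del: upt_Suc)

lemma labelled_gamma_args:
  assumes "t \<in> Sur n k"
    and "list_all2 (\<lambda>x j. x \<in> carrier (scomp A (card (fibre n t j)))) ls [1..<Suc k]"
  shows "labelled A (zip (map (fibre n t) [1..<Suc k]) ls)"
    "labels (zip (map (fibre n t) [1..<Suc k]) ls) = {1..n}"
  using labelled_zip_fibres[OF assms(2)] Union_fibres[OF assms(1)] by (simp_all del: upt_Suc)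

text \<open>Lists the values of a substituted surjection in blocks, in the order in which
  \<open>concat\<close> lists the arguments of the inner operations.\<close>

lemma upt_concat_blocks:
  "[1..<Suc (\<Sum>j\<in>{1..k}. m j)] =
     concat (map (\<lambda>j. map ((+) (\<Sum>i\<in>{1..<j}. m i)) [1..<Suc (m j)]) [1..<Suc k])"
proof (induction k)
  case (Suc k)
  let ?N = "\<Sum>j\<in>{1..k}. m j"
  have "[1..<Suc (\<Sum>j\<in>{1..Suc k}. m j)] = [1..<Suc (?N + m (Suc k))]" by simp
  also have "\<dots> = [1..<Suc ?N] @ [Suc ?N..<Suc ?N + m (Suc k)]"
    using upt_add_eq_append[of 1 "Suc ?N"] by simp
  also have "[Suc ?N..<Suc ?N + m (Suc k)] = map ((+) ?N) [1..<Suc (m (Suc k))]"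
    using map_add_upt[of "Suc ?N" "m (Suc k)"]
    by (intro nth_equalityI) (simp_all del: upt_Suc)
  finally show ?case using Suc by (simp add: atLeastLessThanSuc_atLeastAtMost)
qed simp

text \<open>The offset of a later block is at least the end of any earlier one. So the value of
  \<open>subst_sur\<close> at \<open>a\<close> determines \<open>t a\<close>.\<close>

lemma block_index_unique:
  fixes m :: "nat \<Rightarrow> nat"
  assumes "(\<Sum>i\<in>{1..<j}. m i) + a = (\<Sum>i\<in>{1..<j'}. m i) + a'"
    and "j \<ge> 1" "j' \<ge> 1" "a \<in> {1..m j}" "a' \<in> {1..m j'}"
  shows "j = j'"
proof -
  have less: "(\<Sum>i\<in>{1..<p}. m i) + b < (\<Sum>i\<in>{1..<q}. m i) + b'"
    if "p < q" "1 \<le> p" "b \<in> {1..m p}" "b' \<in> {1..m q}" for p q b b'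
  proof -
    have "(\<Sum>i\<in>{1..<p}. m i) + m p = (\<Sum>i\<in>{1..<Suc p}. m i)" using that by simp
    also have "\<dots> \<le> (\<Sum>i\<in>{1..<q}. m i)" using that by (intro sum_mono2) auto
    finally show ?thesis using that by simp
  qed
  show ?thesis using less[of j j' a a'] less[of j' j a' a] assms
    by (cases j j' rule: linorder_cases) auto
qed

text \<open>The value determines the block \<open>j\<close>, hence the fibre of \<open>t\<close>
  containing the point, and \<open>ts j\<close> then constrains only the rank in this fibre;
  \<open>enum_of\<close> turns ranks back into points.\<close>

lemma fibre_subst_sur:
  assumes "t \<in> Sur n k" "\<And>j. j \<in> {1..k} \<Longrightarrow> ts j \<in> Sur (card (fibre n t j)) (m j)"
    and "j \<in> {1..k}" "i \<in> {1..m j}"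
  shows "fibre n (subst_sur n t m ts) ((\<Sum>i\<in>{1..<j}. m i) + i) =
    enum_of (fibre n t j) ` fibre (card (fibre n t j)) (ts j) i"
proof (intro equalityI subsetI)
  fix a assume "a \<in> fibre n (subst_sur n t m ts) ((\<Sum>i\<in>{1..<j}. m i) + i)"
  then have a: "a \<in> {1..n}" and eq: "(\<Sum>i\<in>{1..<t a}. m i) + ts (t a) (rank_in (fibre n t (t a)) a) =
      (\<Sum>i\<in>{1..<j}. m i) + i"
    by (auto simp: fibre_def subst_sur_def rank_in_def)
  have ta: "t a \<in> {1..k}" by (rule SurD(1)[OF assms(1) a])
  have af: "a \<in> fibre n t (t a)" using a by (simp add: fibre_def)
  have "ts (t a) (rank_in (fibre n t (t a)) a) \<in> {1..m (t a)}"
    by (rule SurD(1)[OF assms(2)[OF ta] rank_in_bounds[OF finite_fibre af]])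
  then have j: "t a = j" using block_index_unique[OF eq] ta assms(3,4) by auto
  then have "rank_in (fibre n t j) a \<in> fibre (card (fibre n t j)) (ts j) i"
    using eq rank_in_bounds[OF finite_fibre af] by (simp add: fibre_def)
  moreover have "enum_of (fibre n t j) (rank_in (fibre n t j) a) = a"
    using af j by (simp add: enum_of_rank_in)
  ultimately show "a \<in> enum_of (fibre n t j) ` fibre (card (fibre n t j)) (ts j) i"
    by (metis imageI)
next
  fix a assume "a \<in> enum_of (fibre n t j) ` fibre (card (fibre n t j)) (ts j) i"
  then obtain b where b: "b \<in> {1..card (fibre n t j)}" "ts j b = i" "a = enum_of (fibre n t j) b"
    by (auto simp: fibre_def)
  then have "a \<in> fibre n t j" "rank_in (fibre n t j) a = b"
    using enum_of_in[OF finite_fibre] rank_in_enum_of[OF finite_fibre] by blast+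
  then show "a \<in> fibre n (subst_sur n t m ts) ((\<Sum>i\<in>{1..<j}. m i) + i)"
    using b by (auto simp: fibre_def subst_sur_def rank_in_def)
qed

lemma zip_concat_map:
  assumes "\<And>j. j \<in> set js \<Longrightarrow> length (f j) = length (g j)"
  shows "zip (concat (map f js)) (concat (map g js)) = concat (map (\<lambda>j. zip (f j) (g j)) js)"
  using assms by (induction js) auto

lemma fibres_subst_sur:
  assumes "t \<in> Sur n k" "\<And>j. j \<in> {1..k} \<Longrightarrow> ts j \<in> Sur (card (fibre n t j)) (m j)"
  shows "map (fibre n (subst_sur n t m ts)) [1..<Suc (\<Sum>j\<in>{1..k}. m j)] =
    concat (map (\<lambda>j. map (\<lambda>i. enum_of (fibre n t j) ` fibre (card (fibre n t j)) (ts j) i)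
      [1..<Suc (m j)]) [1..<Suc k])"
  unfolding upt_concat_blocks map_concat map_map
  by (intro arg_cong[where f = concat] map_cong refl)
    (use fibre_subst_sur[OF assms] in \<open>auto simp del: upt_Suc\<close>)

lemma (in shuffle_algebra) permutad_permutad_of: "permutad K (permutad_of A)"
proof (intro permutad.intro permutad_axioms.intro)
  show "cring K" by (rule is_cring)
  show "module K (pcomp (permutad_of A) n)" for n by (simp add: comp_module)
  show "pid (permutad_of A) \<in> carrier (pcomp (permutad_of A) 1)" by (simp add: one_closed)
  show "bij_betw (\<lambda>c. c \<odot>\<^bsub>pcomp (permutad_of A) 1\<^esub> pid (permutad_of A)) (carrier K)
      (carrier (pcomp (permutad_of A) 1))"
    using one_basis by simp
next
  fix k n :: nat and t assume t: "t \<in> Sur n k"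
  let ?F = "map (fibre n t) [1..<Suc k]"
  let ?Ms = "map (pcomp (permutad_of A)) (input_arities n k t)"
  have tup: "list_all2 (\<lambda>x j. x \<in> carrier (scomp A (card (fibre n t j)))) xs [1..<Suc k]"
    if "xs \<in> tuples ?Ms" for xs
    using that gamma_args_iff[of xs "permutad_of A"] unfolding gamma_args_def by simp
  show "multilinear_map K ?Ms (pcomp (permutad_of A) (n + 1)) (pgamma (permutad_of A) n k t)"
    unfolding multilinear_map_def
  proof (intro conjI ballI allI impI funcsetI)
    fix xs assume xs: "xs \<in> tuples ?Ms"
    note l = labelled_gamma_args[OF t tup[OF xs]]
    then show "pgamma (permutad_of A) n k t xs \<in> carrier (pcomp (permutad_of A) (n + 1))"
      using labelled_prod_closed[OF l(1)] by (simp del: upt_Suc)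
    fix i assume "i < length ?Ms"
    then have i: "i < k" by (simp add: input_arities_def del: upt_Suc)
    have len: "length xs = k" using list_all2_lengthD[OF tup[OF xs]] by simp
    \<comment> \<open>Index \<open>i\<close> of the argument list belongs to the value
      \<open>Suc i\<close> of \<open>t\<close>. Replacing the pair there keeps its label, so only
      the argument changes.\<close>
    have "linear_map K (scomp A (card (fibre n t (Suc i)))) (scomp A n)
        (\<lambda>x. labelled_prod A ((zip ?F xs)[i := (fibre n t (Suc i), x)]))"
      using labelled_prod_linear[OF l(1), of i, unfolded l(2)] i len by (simp del: upt_Suc)
    moreover have "(zip ?F xs)[i := (fibre n t (Suc i), x)] = zip ?F (xs[i := x])" for x
    proof -
      have "?F[i := fibre n t (Suc i)] = ?F"
        using i list_update_id[of ?F i] by (simp del: upt_Suc list_update_id)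
      then show ?thesis by (simp add: update_zip del: upt_Suc)
    qed
    ultimately show "linear_map K (?Ms ! i) (pcomp (permutad_of A) (n + 1))
        (\<lambda>x. pgamma (permutad_of A) n k t (xs[i := x]))"
      using i by (simp add: input_arities_def del: upt_Suc)
  qed
next
  fix n \<mu> assume "\<mu> \<in> carrier (pcomp (permutad_of A) (n + 1))"
  moreover have "fibre n (corolla n) (Suc 0) = {1..n}" by (auto simp: fibre_def corolla_def)
  ultimately show "pgamma (permutad_of A) n 1 (corolla n) [\<mu>] = \<mu>"
    using labelled_prod_single[of "{1..n}" \<mu>] by (simp del: labelled_prod.simps)
next
  fix k n :: nat and t m ts ls
  assume t: "t \<in> Sur n k"
    and ts: "\<And>j. j \<in> {1..k} \<Longrightarrow> ts j \<in> Sur (card (fibre n t j)) (m j)"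
    and ls: "\<And>j. j \<in> {1..k} \<Longrightarrow> ls j \<in> gamma_args (permutad_of A) (card (fibre n t j)) (m j) (ts j)"
  let ?c = "\<lambda>j. card (fibre n t j)"
  \<comment> \<open>\<open>?z j\<close> labels the arguments of the inner operation by subsets of
    \<open>{1..?c j}\<close>; \<open>?e j\<close> moves these labels into the fibre of
    \<open>t\<close> over \<open>j\<close>, which does not change the product.\<close>
  let ?z = "\<lambda>j. zip (map (fibre (?c j) (ts j)) [1..<Suc (m j)]) (ls j)"
  let ?e = "\<lambda>j. map (apfst ((`) (enum_of (fibre n t j)))) (?z j)"
  have z: "labelled A (?z j) \<and> labels (?z j) = {1..?c j}" if "j \<in> {1..k}" for j
    using labelled_gamma_args[OF ts[OF that], of A "ls j"] ls[OF that] unfolding gamma_args_iff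
    by (simp del: upt_Suc)
  have e: "labelled A (?e j) \<and> labels (?e j) = fibre n t j \<and>
      labelled_prod A (?e j) = labelled_prod A (?z j)"
    if "j \<in> {1..k}" for j
    using z[OF that] labelled_relabel labels_relabel labelled_prod_relabel strict_mono_on_enum_of
      strict_mono_on_imp_inj_on enum_of_image[OF finite_fibre] by metis
  have js: "set [1..<Suc k] = {1..k}" by auto
  have fibres: "map (fibre n (subst_sur n t m ts)) [1..<Suc (\<Sum>j\<in>{1..k}. m j)] =
      concat (map (\<lambda>j. map (\<lambda>i. enum_of (fibre n t j) ` fibre (?c j) (ts j) i) [1..<Suc (m j)])
        [1..<Suc k])"
    by (rule fibres_subst_sur[OF t]) (rule ts)
  have "zip (map (fibre n (subst_sur n t m ts)) [1..<Suc (\<Sum>j\<in>{1..k}. m j)])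
      (concat (map ls [1..<Suc k])) = concat (map ?e [1..<Suc k])"
    unfolding fibres
  proof (subst zip_concat_map)
    show "length (map (\<lambda>i. enum_of (fibre n t j) ` fibre (?c j) (ts j) i) [1..<Suc (m j)]) =
        length (ls j)" if "j \<in> set [1..<Suc k]" for j
      using that gamma_args_length[OF ls, of j] by (auto simp del: upt_Suc)
  qed (simp add: zip_map1 apfst_def map_prod_def case_prod_unfold comp_def del: upt_Suc)
  \<comment> \<open>General associativity groups the factors by fibres of \<open>t\<close>; the
    labels of group \<open>j\<close> have the whole fibre as their union.\<close>
  moreover have "labelled_prod A (concat (map ?e [1..<Suc k])) =
      labelled_prod A (map (\<lambda>j. (fibre n t j, labelled_prod A (?z j))) [1..<Suc k])"
  proof (subst labelled_prod_concat)
    show "labelled A (concat (map ?e [1..<Suc k]))"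
      by (rule labelled_concat[where n = n and t = t]) (simp_all only: js e distinct_upt)
    show "labelled_prod A (map (\<lambda>ps. (labels ps, labelled_prod A ps)) (map ?e [1..<Suc k])) =
        labelled_prod A (map (\<lambda>j. (fibre n t j, labelled_prod A (?z j))) [1..<Suc k])"
      unfolding map_map
      by (intro arg_cong[where f = "labelled_prod A"] map_cong refl) (simp only: js e comp_apply)
  qed
  ultimately show "pgamma (permutad_of A) n (\<Sum>j\<in>{1..k}. m j) (subst_sur n t m ts)
      (concat (map ls [1..<Suc k])) =
    pgamma (permutad_of A) n k t
      (map (\<lambda>j. pgamma (permutad_of A) (?c j) (m j) (ts j) (ls j)) [1..<Suc k])"
    by (simp add: zip_map_map zip_same_conv_map comp_def del: upt_Suc)
qed

section \<open>From permutads to shuffle algebras\<close>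

lemma bilinear_map_swap: "bilinear_map K M N L f \<Longrightarrow> bilinear_map K N M L (\<lambda>x y. f y x)"
  by (simp add: bilinear_map_def)

text \<open>The coordinate with respect to the basis \<open>pid P\<close> of the component of arity
  1. The arity is written \<open>Suc 0\<close>, the form the simplifier gives to 1.\<close>

definition unit_coeff :: "('k, 'r) ring_scheme \<Rightarrow> ('k, 'a) permutad_data \<Rightarrow> 'a \<Rightarrow> 'k" where
  "unit_coeff K P = inv_into (carrier K) (\<lambda>c. c \<odot>\<^bsub>pcomp P (Suc 0)\<^esub> pid P)"

text \<open>
  The inverse of \<open>t \<mapsto> \<sigma>\<^sub>t\<close> for \<open>n, m \<ge> 1\<close>; if \<open>n = 0\<close> or \<open>m = 0\<close> it is not a surjection onto
  \<open>{1..2}\<close>, and the product below is scalar multiplication instead.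
\<close>

definition shuffle_sur :: "nat \<Rightarrow> nat \<Rightarrow> (nat \<Rightarrow> nat) \<Rightarrow> nat \<Rightarrow> nat" where
  "shuffle_sur n m \<gamma> = (\<lambda>a\<in>{1..n + m}. if a \<in> \<gamma> ` {1..n} then 1 else 2)"

definition shuffle_algebra_of ::
    "('k, 'r) ring_scheme \<Rightarrow> ('k, 'a) permutad_data \<Rightarrow> ('k, 'a) shuffle_algebra_data" where
  "shuffle_algebra_of K P =
     \<lparr>scomp = (\<lambda>n. pcomp P (n + 1)), sone = pid P,
      sprod = (\<lambda>n m \<gamma> x y.
        if n = 0 then unit_coeff K P x \<odot>\<^bsub>pcomp P (m + 1)\<^esub> y
        else if m = 0 then unit_coeff K P y \<odot>\<^bsub>pcomp P (n + 1)\<^esub> x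
        else pgamma P (n + m) 2 (shuffle_sur n m \<gamma>) [x, y])\<rparr>"

lemma shuffle_algebra_of_simps [simp]:
  "scomp (shuffle_algebra_of K P) = (\<lambda>n. pcomp P (n + 1))"
  "sone (shuffle_algebra_of K P) = pid P"
  by (simp_all add: shuffle_algebra_of_def)

lemma sprod_shuffle_algebra_of:
  "sprod (shuffle_algebra_of K P) 0 m \<gamma> x y = unit_coeff K P x \<odot>\<^bsub>pcomp P (m + 1)\<^esub> y"
  "n \<noteq> 0 \<Longrightarrow> sprod (shuffle_algebra_of K P) n 0 \<gamma> x y = unit_coeff K P y \<odot>\<^bsub>pcomp P (n + 1)\<^esub> x"
  "n \<noteq> 0 \<Longrightarrow> m \<noteq> 0 \<Longrightarrow> sprod (shuffle_algebra_of K P) n m \<gamma> x y =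
     pgamma P (n + m) 2 (shuffle_sur n m \<gamma>) [x, y]"
  by (simp_all add: shuffle_algebra_of_def)

section \<open>The surjection of a shuffle\<close>

lemma shuffle_sur_apply:
  assumes "\<gamma> \<in> Sh [n, m]" "i \<in> {1..n + m}"
  shows "shuffle_sur n m \<gamma> (\<gamma> i) = (if i \<le> n then 1 else 2)"
proof -
  have p: "\<gamma> permutes {1..n + m}" using assms(1) by (simp add: Sh2_iff)
  have "\<gamma> i \<in> {1..n + m}" using assms(2) permutes_in_image[OF p] by blast
  moreover have "\<gamma> i \<in> \<gamma> ` {1..n} \<longleftrightarrow> i \<le> n"
    using assms(2) by (subst inj_image_mem_iff[OF permutes_inj[OF p]]) auto
  ultimately show ?thesis by (simp only: shuffle_sur_def restrict_apply if_True)
qed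

lemma fibres_shuffle_sur:
  assumes "\<gamma> \<in> Sh [n, m]"
  shows "fibre (n + m) (shuffle_sur n m \<gamma>) 1 = \<gamma> ` {1..n}"
    "fibre (n + m) (shuffle_sur n m \<gamma>) 2 = \<gamma> ` {n + 1..n + m}"
    "card (\<gamma> ` {1..n}) = n" "card (\<gamma> ` {n + 1..n + m}) = m"
proof -
  have p: "\<gamma> permutes {1..n + m}" using assms by (simp add: Sh2_iff)
  show "card (\<gamma> ` {1..n}) = n" "card (\<gamma> ` {n + 1..n + m}) = m"
    using permutes_inj[OF p] by (subst card_image; auto intro: inj_on_subset)+
  have f: "fibre (n + m) (shuffle_sur n m \<gamma>) v =
      \<gamma> ` {i \<in> {1..n + m}. (if i \<le> n then 1 else 2) = v}" for v
  proof -
    have "fibre (n + m) (shuffle_sur n m \<gamma>) v = {a \<in> \<gamma> ` {1..n + m}. shuffle_sur n m \<gamma> a = v}"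
      by (simp only: fibre_def permutes_image[OF p])
    also have "\<dots> = \<gamma> ` {i \<in> {1..n + m}. shuffle_sur n m \<gamma> (\<gamma> i) = v}" by blast
    also have "{i \<in> {1..n + m}. shuffle_sur n m \<gamma> (\<gamma> i) = v} =
        {i \<in> {1..n + m}. (if i \<le> n then 1 else 2) = v}"
      by (rule Collect_cong) (metis shuffle_sur_apply[OF assms])
    finally show ?thesis .
  qed
  show "fibre (n + m) (shuffle_sur n m \<gamma>) 1 = \<gamma> ` {1..n}"
    "fibre (n + m) (shuffle_sur n m \<gamma>) 2 = \<gamma> ` {n + 1..n + m}"
    unfolding f by (intro arg_cong[where f = "image \<gamma>"]; auto split: if_splits)+
qed

lemma shuffle_sur_in_Sur:
  assumes "\<gamma> \<in> Sh [n, m]" "n \<noteq> 0" "m \<noteq> 0"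
  shows "shuffle_sur n m \<gamma> \<in> Sur (n + m) 2"
proof (rule SurI)
  fix j assume "j \<in> {1..2::nat}"
  then have "j = 1 \<or> j = 2" by auto
  moreover have "fibre (n + m) (shuffle_sur n m \<gamma>) 1 \<noteq> {}" "fibre (n + m) (shuffle_sur n m \<gamma>) 2 \<noteq> {}"
    unfolding fibres_shuffle_sur[OF assms(1)] using assms(2,3) by auto
  ultimately show "\<exists>a\<in>{1..n + m}. shuffle_sur n m \<gamma> a = j" by (auto simp: fibre_def)
qed (auto simp: shuffle_sur_def)

text \<open>A surjection onto \<open>{1..2}\<close> is determined by its fibre over 1, and that
  fibre is all that \<open>shuffle_sur\<close> reads from the shuffle.\<close>

lemma shuffle_sur_of_image:
  assumes "t \<in> Sur n 2" "\<gamma> ` {1..card (fibre n t 1)} = fibre n t 1"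
  shows "shuffle_sur (card (fibre n t 1)) (card (fibre n t 2)) \<gamma> = t"
proof
  fix a
  have "t a = 1 \<or> t a = 2" if "a \<in> {1..n}" using SurD(1)[OF assms(1) that] by auto
  then show "shuffle_sur (card (fibre n t 1)) (card (fibre n t 2)) \<gamma> a = t a"
    unfolding shuffle_sur_def assms(2) Sur2_fibres(2)[OF assms(1)]
    using SurD(3)[OF assms(1)] by (auto simp: fibre_def)
qed

lemma shuffle_sur_shuffle_of:
  assumes "t \<in> Sur n 2"
  shows "shuffle_sur (card (fibre n t 1)) (card (fibre n t 2)) (shuffle_of n 2 t) = t"
proof (rule shuffle_sur_of_image[OF assms])
  have "rank_in {1..n} ` fibre n t 1 = id ` fibre n t 1"
    by (rule image_cong) (simp_all only: rank_in_interval subsetD[OF fibre_subset] id_apply)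
  then show "shuffle_of n 2 t ` {1..card (fibre n t 1)} = fibre n t 1"
    unfolding shuffle_of_two[OF assms] shuffle_sets_image_left[OF finite_fibre]
      Sur2_fibres(1)[OF assms] by simp
qed

lemma upt_two: "[1..<Suc 2] = [1, 2]"
  by (simp add: upt_rec numeral_2_eq_2)

lemma input_arities_two: "input_arities n 2 t = [card (fibre n t 1) + 1, card (fibre n t 2) + 1]"
  by (simp only: input_arities_def upt_two list.map)

lemma gamma_args_two:
  "[x, y] \<in> gamma_args P n 2 t \<longleftrightarrow> x \<in> carrier (pcomp P (card (fibre n t 1) + 1)) \<and>
     y \<in> carrier (pcomp P (card (fibre n t 2) + 1))"
  unfolding gamma_args_iff upt_two by simp

lemma fibre_corolla: "fibre n (corolla n) 1 = {1..n}"
  by (auto simp: fibre_def corolla_def)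

lemma gamma_args_corolla: "[x] \<in> gamma_args P n 1 (corolla n) \<longleftrightarrow> x \<in> carrier (pcomp P (n + 1))"
  using fibre_corolla[of n] by (simp add: gamma_args_iff)

lemma corolla_in_Sur: "n \<noteq> 0 \<Longrightarrow> corolla n \<in> Sur n 1"
  by (rule SurI) (auto simp: corolla_def)

lemma Sur_one: "t \<in> Sur n 1 \<Longrightarrow> t = corolla n"
  using SurD(1,3)[of t n 1] by (force simp: corolla_def)

lemma rank_in_shifted_interval: "j \<in> {1..p} \<Longrightarrow> rank_in {n + 1..n + p} (n + j) = j"
proof -
  assume "j \<in> {1..p}"
  then have "{b \<in> {n + 1..n + p}. b \<le> n + j} = {n + 1..n + j}" by auto
  then show ?thesis by (simp add: rank_in_def)
qed

text \<open>The substitution \<open>subst_sur\<close> into a surjection onto \<open>{1..2}\<close>,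
  the only case that the passage from permutads to shuffle algebras uses. \<open>k\<close> is the
  number of values of \<open>t1\<close>, hence the offset of \<open>t2\<close>.\<close>

definition subst_two ::
    "nat \<Rightarrow> (nat \<Rightarrow> nat) \<Rightarrow> nat \<Rightarrow> (nat \<Rightarrow> nat) \<Rightarrow> (nat \<Rightarrow> nat) \<Rightarrow> nat \<Rightarrow> nat" where
  "subst_two n t k t1 t2 = (\<lambda>a\<in>{1..n}. if t a = 1 then t1 (rank_in (fibre n t 1) a)
     else k + t2 (rank_in (fibre n t 2) a))"

text \<open>Both sides mark a point by 1, 2 or 3 according to whether the three-block shuffle takes
  it from the first \<open>n\<close>, the next \<open>m\<close> or the last \<open>r\<close>
  positions; \<open>eq\<close> says that both factorisations give the same three-block
  shuffle.\<close>

lemma subst_two_shuffle_assoc: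
  assumes "\<gamma> \<in> Sh [n, m + r]" "\<delta> \<in> Sh [m, r]" "\<sigma> \<in> Sh [n, m]" "\<rho> \<in> Sh [n + m, r]"
    and eq: "\<gamma> \<circ> perm_times n (m + r) id \<delta> = \<rho> \<circ> perm_times (n + m) r \<sigma> id"
  shows "subst_two (n + (m + r)) (shuffle_sur n (m + r) \<gamma>) 1 (corolla n) (shuffle_sur m r \<delta>) =
    subst_two (n + m + r) (shuffle_sur (n + m) r \<rho>) 2 (shuffle_sur n m \<sigma>) (corolla r)"
    (is "?l = ?r")
proof
  fix a
  have p\<gamma>: "\<gamma> permutes {1..n + (m + r)}" and p\<delta>: "\<delta> permutes {1..m + r}"
    and p\<sigma>: "\<sigma> permutes {1..n + m}" and p\<rho>: "\<rho> permutes {1..n + m + r}"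
    using assms by (simp_all add: Sh2_iff)
  let ?tg = "shuffle_sur n (m + r) \<gamma>" and ?tr = "shuffle_sur (n + m) r \<rho>"
  \<comment> \<open>A shuffle is increasing on each block, so the rank of a value among the values
    of its block is the position of its argument in the block. The same holds for the next three
    facts.\<close>
  have rl: "rank_in (fibre (n + m + r) ?tr 1) (\<rho> b) = b" if "b \<in> {1..n + m}" for b
    unfolding fibres_shuffle_sur[OF assms(4)]
    using rank_in_relabel[of "{1..n + m}" \<rho> b] that assms(4) rank_in_interval[OF that]
    by (simp add: Sh2_iff)
  have rr: "rank_in (fibre (n + m + r) ?tr 2) (\<rho> (n + m + b)) = b" if "b \<in> {1..r}" for b
    unfolding fibres_shuffle_sur[OF assms(4)]
    using rank_in_relabel[of "{n + m + 1..n + m + r}" \<rho> "n + m + b"] that assms(4)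
      rank_in_shifted_interval[OF that]
    by (simp add: Sh2_iff)
  have gl: "rank_in (fibre (n + (m + r)) ?tg 1) (\<gamma> b) = b" if "b \<in> {1..n}" for b
    unfolding fibres_shuffle_sur[OF assms(1)]
    using rank_in_relabel[of "{1..n}" \<gamma> b] that assms(1) rank_in_interval[OF that]
    by (simp add: Sh2_iff)
  have gr: "rank_in (fibre (n + (m + r)) ?tg 2) (\<gamma> (n + b)) = b" if "b \<in> {1..m + r}" for b
    unfolding fibres_shuffle_sur[OF assms(1)]
    using rank_in_relabel[of "{n + 1..n + (m + r)}" \<gamma> "n + b"] that assms(1)
      rank_in_shifted_interval[OF that]
    by (simp add: Sh2_iff)
  have L: "?l (\<gamma> b) = (if b \<le> n then 1 else 1 + shuffle_sur m r \<delta> (b - n))"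
    if "b \<in> {1..n + (m + r)}" for b
  proof -
    have "\<gamma> b \<in> {1..n + (m + r)}" using that permutes_in_image[OF p\<gamma>] by blast
    moreover have "b \<in> {1..n}" if "b \<le> n" using that \<open>b \<in> {1..n + (m + r)}\<close> by simp
    moreover have "b - n \<in> {1..m + r}" if "\<not> b \<le> n" using that \<open>b \<in> {1..n + (m + r)}\<close> by auto
    ultimately show ?thesis
      using shuffle_sur_apply[OF assms(1) that] gl[of b] gr[of "b - n"]
      by (cases "b \<le> n") (simp_all add: subst_two_def corolla_def)
  qed
  have R: "?r (\<rho> b) = (if b \<le> n + m then shuffle_sur n m \<sigma> b else 3)"
    if "b \<in> {1..n + m + r}" for b
  proof -
    have "\<rho> b \<in> {1..n + m + r}" using that permutes_in_image[OF p\<rho>] by blast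
    moreover have "b \<in> {1..n + m}" if "b \<le> n + m" using that \<open>b \<in> {1..n + m + r}\<close> by simp
    moreover have "b - (n + m) \<in> {1..r}" if "\<not> b \<le> n + m"
      using that \<open>b \<in> {1..n + m + r}\<close> by auto
    ultimately show ?thesis
      using shuffle_sur_apply[OF assms(4) that] rl[of b] rr[of "b - (n + m)"]
      by (cases "b \<le> n + m") (simp_all add: subst_two_def corolla_def)
  qed
  show "?l a = ?r a"
  proof (cases "a \<in> {1..n + (m + r)}")
    case True
    then obtain b where b: "b \<in> {1..n + (m + r)}" "a = \<gamma> b"
      using permutes_image[OF p\<gamma>] by blast
    show ?thesis
    proof (cases "b \<le> n")
      case True
      then have "perm_times n (m + r) id \<delta> b = b" "perm_times (n + m) r \<sigma> id b = \<sigma> b"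
        using b by (auto simp: perm_times_def)
      then have a: "a = \<rho> (\<sigma> b)" using fun_cong[OF eq, of b] b by simp
      have b': "b \<in> {1..n + m}" using b True by auto
      then have "\<sigma> b \<in> {1..n + m}" using permutes_in_image[OF p\<sigma>] by blast
      then have "?r a = 1" using R[of "\<sigma> b"] shuffle_sur_apply[OF assms(3) b'] True by (simp add: a)
      then show ?thesis using L[OF b(1)] True by (simp add: b)
    next
      case False
      then have "b - n \<in> {1..m + r}" using b by auto
      \<comment> \<open>Since \<open>b = n + \<delta> c\<close>, the position \<open>n + c\<close>
        is the one that both composites in \<open>eq\<close> send to \<open>a\<close>.\<close>
      then obtain c where c: "c \<in> {1..m + r}" "b = n + \<delta> c"
        using permutes_image[OF p\<delta>] False by (metis imageE le_add_diff_inverse nat_le_linear)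
      then have l: "perm_times n (m + r) id \<delta> (n + c) = b" by (auto simp: perm_times_def)
      have La: "?l a = (if c \<le> m then 2 else 3)"
        using L[OF b(1)] False c shuffle_sur_apply[OF assms(2) c(1)] by (simp add: b)
      show ?thesis
      proof (cases "c \<le> m")
        case True
        then have "perm_times (n + m) r \<sigma> id (n + c) = \<sigma> (n + c)" by (simp add: perm_times_def)
        then have a: "a = \<rho> (\<sigma> (n + c))" using fun_cong[OF eq, of "n + c"] b l by simp
        have c': "n + c \<in> {1..n + m}" using c True by auto
        then have "\<sigma> (n + c) \<in> {1..n + m}" using permutes_in_image[OF p\<sigma>] by blast
        then have "?r a = 2"
          using R[of "\<sigma> (n + c)"] shuffle_sur_apply[OF assms(3) c'] c(1) by (simp add: a)
        then show ?thesis using La True by simp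
      next
        case False
        then have "perm_times (n + m) r \<sigma> id (n + c) = n + c"
          using c(1) by (simp add: perm_times_def)
        then have a: "a = \<rho> (n + c)" using fun_cong[OF eq, of "n + c"] b l by simp
        have "?r a = 3" using R[of "n + c"] c(1) False by (simp add: a)
        then show ?thesis using La False by simp
      qed
    qed
  next
    case False
    then show ?thesis by (auto simp: subst_two_def)
  qed
qed

context permutad
begin

section \<open>Scalars from the component of arity 1, and the products of a permutad\<close>

lemma unit_coeff_closed:
  assumes "x \<in> carrier (pcomp P (Suc 0))"
  shows "unit_coeff K P x \<in> carrier K" "unit_coeff K P x \<odot>\<^bsub>pcomp P (Suc 0)\<^esub> pid P = x"
proof -
  have "x \<in> (\<lambda>c. c \<odot>\<^bsub>pcomp P (Suc 0)\<^esub> pid P) ` carrier K"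
    using id_basis assms by (simp add: bij_betw_def)
  then show "unit_coeff K P x \<in> carrier K" "unit_coeff K P x \<odot>\<^bsub>pcomp P (Suc 0)\<^esub> pid P = x"
    unfolding unit_coeff_def by (rule inv_into_into, rule f_inv_into_f)
qed

lemma unit_coeff_smult_id:
  assumes "c \<in> carrier K"
  shows "unit_coeff K P (c \<odot>\<^bsub>pcomp P (Suc 0)\<^esub> pid P) = c"
  unfolding unit_coeff_def
  by (rule inv_into_f_f) (use id_basis assms in \<open>simp_all add: bij_betw_def\<close>)

lemma unit_coeff_id: "unit_coeff K P (pid P) = \<one>"
proof -
  interpret M: module K "pcomp P (Suc 0)" by (rule comp_module) simp
  show ?thesis using unit_coeff_smult_id[OF one_closed] id_closed by simp
qed

lemma unit_coeff_add:
  assumes "x \<in> carrier (pcomp P (Suc 0))" "y \<in> carrier (pcomp P (Suc 0))"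
  shows "unit_coeff K P (x \<oplus>\<^bsub>pcomp P (Suc 0)\<^esub> y) = unit_coeff K P x \<oplus> unit_coeff K P y"
proof -
  interpret M: module K "pcomp P (Suc 0)" by (rule comp_module) simp
  have "x \<oplus>\<^bsub>pcomp P (Suc 0)\<^esub> y = (unit_coeff K P x \<oplus> unit_coeff K P y) \<odot>\<^bsub>pcomp P (Suc 0)\<^esub> pid P"
    using unit_coeff_closed assms id_closed by (simp add: M.smult_l_distr)
  then show ?thesis using unit_coeff_smult_id unit_coeff_closed assms by simp
qed

lemma unit_coeff_smult:
  assumes "c \<in> carrier K" "x \<in> carrier (pcomp P (Suc 0))"
  shows "unit_coeff K P (c \<odot>\<^bsub>pcomp P (Suc 0)\<^esub> x) = c \<otimes> unit_coeff K P x"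
proof -
  interpret M: module K "pcomp P (Suc 0)" by (rule comp_module) simp
  have "c \<odot>\<^bsub>pcomp P (Suc 0)\<^esub> x = (c \<otimes> unit_coeff K P x) \<odot>\<^bsub>pcomp P (Suc 0)\<^esub> pid P"
    using unit_coeff_closed assms id_closed by (simp add: M.smult_assoc1)
  then show ?thesis using unit_coeff_smult_id unit_coeff_closed assms by simp
qed

lemma unit_action_bilinear:
  assumes "n \<ge> 1"
  shows "bilinear_map K (pcomp P (Suc 0)) (pcomp P n) (pcomp P n)
    (\<lambda>x y. unit_coeff K P x \<odot>\<^bsub>pcomp P n\<^esub> y)"
proof -
  interpret M: module K "pcomp P n" by (rule comp_module[OF assms])
  show ?thesis
    using unit_coeff_closed
    by (auto simp: bilinear_map_def linear_map_def unit_coeff_add unit_coeff_smult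
        M.smult_l_distr M.smult_r_distr M.smult_assoc1[symmetric] m_comm)
qed

lemma gamma_closed:
  assumes "1 \<le> k" "t \<in> Sur n k" "ls \<in> gamma_args P n k t"
  shows "pgamma P n k t ls \<in> carrier (pcomp P (n + 1))"
  using gamma_multilinear[OF assms(1) Sur_le[OF assms(2)] assms(2)] assms(3)
  by (auto simp: multilinear_map_def gamma_args_def)

lemma gamma_two_bilinear:
  assumes "t \<in> Sur n 2"
  shows "bilinear_map K (pcomp P (card (fibre n t 1) + 1)) (pcomp P (card (fibre n t 2) + 1))
    (pcomp P (n + 1)) (\<lambda>x y. pgamma P n 2 t [x, y])"
proof -
  let ?Ms = "[pcomp P (card (fibre n t 1) + 1), pcomp P (card (fibre n t 2) + 1)]"
  have "multilinear_map K ?Ms (pcomp P (n + 1)) (pgamma P n 2 t)"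
    using gamma_multilinear[of 2 n t] Sur_le[OF assms] assms by (simp add: input_arities_two)
  then have lin: "linear_map K (?Ms ! i) (pcomp P (n + 1)) (\<lambda>x. pgamma P n 2 t (xs[i := x]))"
    if "xs \<in> tuples ?Ms" "i < 2" for xs i
    using that by (simp add: multilinear_map_def)
  \<comment> \<open>Multilinearity speaks of overwriting an entry of a given tuple, so the entry
    that varies starts out as zero.\<close>
  have zero: "\<zero>\<^bsub>pcomp P (j + 1)\<^esub> \<in> carrier (pcomp P (j + 1))" for j
  proof -
    interpret M: module K "pcomp P (Suc j)" by (rule comp_module) simp
    show ?thesis by simp
  qed
  show ?thesis unfolding bilinear_map_def
  proof (intro conjI ballI)
    fix y assume "y \<in> carrier (pcomp P (card (fibre n t 2) + 1))"
    then have "[\<zero>\<^bsub>pcomp P (card (fibre n t 1) + 1)\<^esub>, y] \<in> tuples ?Ms"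
      using zero by (simp add: tuples_def)
    from lin[OF this, of 0] show "linear_map K (pcomp P (card (fibre n t 1) + 1)) (pcomp P (n + 1))
        (\<lambda>x. pgamma P n 2 t [x, y])" by simp
  next
    fix x assume "x \<in> carrier (pcomp P (card (fibre n t 1) + 1))"
    then have "[x, \<zero>\<^bsub>pcomp P (card (fibre n t 2) + 1)\<^esub>] \<in> tuples ?Ms"
      using zero by (simp add: tuples_def)
    from lin[OF this, of 1] show "linear_map K (pcomp P (card (fibre n t 2) + 1)) (pcomp P (n + 1))
        (\<lambda>y. pgamma P n 2 t [x, y])" by simp
  qed
qed

text \<open>The permutad axiom for an outer surjection onto \<open>{1..2}\<close>, with the families
  indexed by \<open>j\<close> unpacked into pairs.\<close>

lemma gamma_subst_two:
  assumes t: "t \<in> Sur n 2"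
    and t1: "t1 \<in> Sur (card (fibre n t 1)) k1" and t2: "t2 \<in> Sur (card (fibre n t 2)) k2"
    and l1: "l1 \<in> gamma_args P (card (fibre n t 1)) k1 t1"
    and l2: "l2 \<in> gamma_args P (card (fibre n t 2)) k2 t2"
  shows "pgamma P n (k1 + k2) (subst_two n t k1 t1 t2) (l1 @ l2) =
    pgamma P n 2 t [pgamma P (card (fibre n t 1)) k1 t1 l1, pgamma P (card (fibre n t 2)) k2 t2 l2]"
proof -
  let ?m = "\<lambda>j::nat. if j = 1 then k1 else k2"
  let ?ts = "\<lambda>j::nat. if j = 1 then t1 else t2"
  let ?ls = "\<lambda>j::nat. if j = 1 then l1 else l2"
  have two: "j = 1 \<or> j = 2" if "j \<in> {1..2::nat}" for j using that by auto
  have "pgamma P n (\<Sum>j\<in>{1..2}. ?m j) (subst_sur n t ?m ?ts) (concat (map ?ls [1..<Suc 2])) =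
      pgamma P n 2 t (map (\<lambda>j. pgamma P (card (fibre n t j)) (?m j) (?ts j) (?ls j)) [1..<Suc 2])"
  proof (rule gamma_assoc)
    fix j :: nat assume "j \<in> {1..2}"
    then show "?ts j \<in> Sur (card (fibre n t j)) (?m j)"
      "?ls j \<in> gamma_args P (card (fibre n t j)) (?m j) (?ts j)"
      using two[of j] t1 t2 l1 l2 by auto
  qed (use t Sur_le[OF t] in simp_all)
  moreover have "{1..2::nat} = {1, 2}" by auto
  then have "(\<Sum>j\<in>{1..2}. ?m j) = k1 + k2" by simp
  moreover have "subst_sur n t ?m ?ts = subst_two n t k1 t1 t2"
  proof
    fix a
    have "{1..<2::nat} = {1}" by auto
    then have sums: "(\<Sum>j\<in>{1..<2}. ?m j) = k1" "(\<Sum>j\<in>{1..<1}. ?m j) = 0" by simp_all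
    show "subst_sur n t ?m ?ts a = subst_two n t k1 t1 t2 a"
    proof (cases "a \<in> {1..n}")
      case True
      then consider "t a = 1" | "t a = 2" using two[OF SurD(1)[OF t]] by blast
      then show ?thesis
        unfolding subst_sur_def subst_two_def rank_in_def restrict_apply if_P[OF True]
        by cases (simp_all only: sums, simp_all)
    next
      case False
      then show ?thesis by (simp only: subst_sur_def subst_two_def restrict_apply if_False)
    qed
  qed
  ultimately show ?thesis unfolding upt_two by simp
qed

lemma gamma_shuffle_assoc:
  assumes sh: "\<gamma> \<in> Sh [n, m + r]" "\<delta> \<in> Sh [m, r]" "\<sigma> \<in> Sh [n, m]" "\<rho> \<in> Sh [n + m, r]"
    and eq: "\<gamma> \<circ> perm_times n (m + r) id \<delta> = \<rho> \<circ> perm_times (n + m) r \<sigma> id"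
    and pos: "n \<noteq> 0" "m \<noteq> 0" "r \<noteq> 0"
    and x: "x \<in> carrier (pcomp P (n + 1))" and y: "y \<in> carrier (pcomp P (m + 1))"
    and z: "z \<in> carrier (pcomp P (r + 1))"
  shows "pgamma P (n + (m + r)) 2 (shuffle_sur n (m + r) \<gamma>)
      [x, pgamma P (m + r) 2 (shuffle_sur m r \<delta>) [y, z]] =
    pgamma P (n + m + r) 2 (shuffle_sur (n + m) r \<rho>)
      [pgamma P (n + m) 2 (shuffle_sur n m \<sigma>) [x, y], z]"
proof -
  note f\<gamma> = fibres_shuffle_sur[OF sh(1)] and f\<delta> = fibres_shuffle_sur[OF sh(2)]
    and f\<sigma> = fibres_shuffle_sur[OF sh(3)] and f\<rho> = fibres_shuffle_sur[OF sh(4)]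
  have s: "shuffle_sur n (m + r) \<gamma> \<in> Sur (n + (m + r)) 2" "shuffle_sur m r \<delta> \<in> Sur (m + r) 2"
    "shuffle_sur n m \<sigma> \<in> Sur (n + m) 2" "shuffle_sur (n + m) r \<rho> \<in> Sur (n + m + r) 2"
    using shuffle_sur_in_Sur sh pos by auto
  \<comment> \<open>The axiom substitutes into both values at once, so the argument that is not a
    product is first written as \<Gamma> of a corolla.\<close>
  have "pgamma P (n + (m + r)) 2 (shuffle_sur n (m + r) \<gamma>)
      [pgamma P n 1 (corolla n) [x], pgamma P (m + r) 2 (shuffle_sur m r \<delta>) [y, z]] =
    pgamma P (n + (m + r)) (1 + 2)
      (subst_two (n + (m + r)) (shuffle_sur n (m + r) \<gamma>) 1 (corolla n) (shuffle_sur m r \<delta>))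
      ([x] @ [y, z])"
    using gamma_subst_two[OF s(1), of "corolla n" 1 "shuffle_sur m r \<delta>" 2 "[x]" "[y, z]"]
      corolla_in_Sur[OF pos(1)] s(2) x y z
    by (simp only: f\<gamma> f\<delta> gamma_args_corolla gamma_args_two simp_thms)
  moreover have "pgamma P (n + m + r) 2 (shuffle_sur (n + m) r \<rho>)
      [pgamma P (n + m) 2 (shuffle_sur n m \<sigma>) [x, y], pgamma P r 1 (corolla r) [z]] =
    pgamma P (n + m + r) (2 + 1)
      (subst_two (n + m + r) (shuffle_sur (n + m) r \<rho>) 2 (shuffle_sur n m \<sigma>) (corolla r))
      ([x, y] @ [z])"
    using gamma_subst_two[OF s(4), of "shuffle_sur n m \<sigma>" 2 "corolla r" 1 "[x, y]" "[z]"]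
      corolla_in_Sur[OF pos(3)] s(3) x y z
    by (simp only: f\<rho> f\<sigma> gamma_args_corolla gamma_args_two simp_thms)
  moreover have "pgamma P n 1 (corolla n) [x] = x" "pgamma P r 1 (corolla r) [z] = z"
    using gamma_corolla x z pos by simp_all
  ultimately show ?thesis
    by (simp add: subst_two_shuffle_assoc[OF sh eq, simplified] numeral_3_eq_3 add.assoc)
qed

lemma sprod_bilinear:
  assumes "\<gamma> \<in> Sh [n, m]"
  shows "bilinear_map K (pcomp P (n + 1)) (pcomp P (m + 1)) (pcomp P (n + m + 1))
    (sprod (shuffle_algebra_of K P) n m \<gamma>)"
proof -
  consider "n = 0" | "n \<noteq> 0" "m = 0" | "n \<noteq> 0" "m \<noteq> 0" by blast
  then show ?thesis
  proof cases
    case 1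
    then show ?thesis using unit_action_bilinear[of "m + 1"]
      by (simp add: sprod_shuffle_algebra_of bilinear_map_def)
  next
    case 2
    then show ?thesis using bilinear_map_swap[OF unit_action_bilinear[of "n + 1"]]
      by (simp add: sprod_shuffle_algebra_of bilinear_map_def)
  next
    case 3
    then show ?thesis using gamma_two_bilinear[OF shuffle_sur_in_Sur[OF assms]]
      unfolding fibres_shuffle_sur[OF assms] by (simp add: sprod_shuffle_algebra_of bilinear_map_def)
  qed
qed

text \<open>If both degrees are 0, the definition lets the left factor act on the right one.
  Commutativity of \<open>K\<close> makes this symmetric: either way the coordinates are
  multiplied.\<close>

lemma sprod_unit:
  assumes "x \<in> carrier (pcomp P (n + 1))" "u \<in> carrier (pcomp P (Suc 0))"
  shows "sprod (shuffle_algebra_of K P) 0 n \<gamma> u x = unit_coeff K P u \<odot>\<^bsub>pcomp P (n + 1)\<^esub> x"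
    "sprod (shuffle_algebra_of K P) n 0 \<gamma> x u = unit_coeff K P u \<odot>\<^bsub>pcomp P (n + 1)\<^esub> x"
proof -
  show "sprod (shuffle_algebra_of K P) 0 n \<gamma> u x = unit_coeff K P u \<odot>\<^bsub>pcomp P (n + 1)\<^esub> x"
    by (simp add: sprod_shuffle_algebra_of)
  show "sprod (shuffle_algebra_of K P) n 0 \<gamma> x u = unit_coeff K P u \<odot>\<^bsub>pcomp P (n + 1)\<^esub> x"
  proof (cases "n = 0")
    case True
    interpret M: module K "pcomp P (Suc 0)" by (rule comp_module) simp
    have x: "x \<in> carrier (pcomp P (Suc 0))" using assms True by simp
    note cx = unit_coeff_closed[OF x] and cu = unit_coeff_closed[OF assms(2)]
    have "unit_coeff K P x \<odot>\<^bsub>pcomp P (Suc 0)\<^esub> u =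
        (unit_coeff K P x \<otimes> unit_coeff K P u) \<odot>\<^bsub>pcomp P (Suc 0)\<^esub> pid P"
      using M.smult_assoc1[OF cx(1) cu(1) id_closed[unfolded One_nat_def]] cu(2) by simp
    also have "\<dots> = unit_coeff K P u \<odot>\<^bsub>pcomp P (Suc 0)\<^esub> x"
      using M.smult_assoc1[OF cu(1) cx(1) id_closed[unfolded One_nat_def]] cx(2) m_comm[OF cu(1) cx(1)]
      by simp
    finally show ?thesis using True by (simp add: sprod_shuffle_algebra_of)
  next
    case False
    then show ?thesis by (simp add: sprod_shuffle_algebra_of)
  qed
qed

lemma sprod_closed:
  assumes "\<gamma> \<in> Sh [n, m]" "x \<in> carrier (pcomp P (n + 1))" "y \<in> carrier (pcomp P (m + 1))"
  shows "sprod (shuffle_algebra_of K P) n m \<gamma> x y \<in> carrier (pcomp P (n + m + 1))"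
  using sprod_bilinear[OF assms(1)] assms(2,3) by (auto simp: bilinear_map_def linear_map_def)

lemma sprod_smult:
  assumes "\<gamma> \<in> Sh [n, m]" "x \<in> carrier (pcomp P (n + 1))" "y \<in> carrier (pcomp P (m + 1))"
    "c \<in> carrier K"
  shows "sprod (shuffle_algebra_of K P) n m \<gamma> (c \<odot>\<^bsub>pcomp P (n + 1)\<^esub> x) y =
      c \<odot>\<^bsub>pcomp P (n + m + 1)\<^esub> sprod (shuffle_algebra_of K P) n m \<gamma> x y"
    "sprod (shuffle_algebra_of K P) n m \<gamma> x (c \<odot>\<^bsub>pcomp P (m + 1)\<^esub> y) =
      c \<odot>\<^bsub>pcomp P (n + m + 1)\<^esub> sprod (shuffle_algebra_of K P) n m \<gamma> x y"
  using sprod_bilinear[OF assms(1)] assms(2-4) by (auto simp: bilinear_map_def linear_map_def)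

lemma shuffle_algebra_shuffle_algebra_of: "shuffle_algebra K (shuffle_algebra_of K P)"
proof (intro shuffle_algebra.intro shuffle_algebra_axioms.intro)
  show "cring K" by (rule is_cring)
  show "module K (scomp (shuffle_algebra_of K P) n)" for n by (simp add: comp_module)
  show "sone (shuffle_algebra_of K P) \<in> carrier (scomp (shuffle_algebra_of K P) 0)"
    using id_closed by simp
  show "bij_betw (\<lambda>c. c \<odot>\<^bsub>scomp (shuffle_algebra_of K P) 0\<^esub> sone (shuffle_algebra_of K P)) (carrier K)
      (carrier (scomp (shuffle_algebra_of K P) 0))"
    using id_basis by simp
next
  fix \<gamma> n m assume "\<gamma> \<in> Sh [n, m]"
  from sprod_bilinear[OF this] show "bilinear_map K (scomp (shuffle_algebra_of K P) n)
      (scomp (shuffle_algebra_of K P) m) (scomp (shuffle_algebra_of K P) (n + m))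
      (sprod (shuffle_algebra_of K P) n m \<gamma>)" by simp
next
  fix \<gamma> n x assume "x \<in> carrier (scomp (shuffle_algebra_of K P) n)"
  then have x: "x \<in> carrier (pcomp P (n + 1))" by simp
  interpret M: module K "pcomp P (Suc n)" by (rule comp_module) simp
  show "sprod (shuffle_algebra_of K P) 0 n \<gamma> (sone (shuffle_algebra_of K P)) x = x"
    "sprod (shuffle_algebra_of K P) n 0 \<gamma> x (sone (shuffle_algebra_of K P)) = x"
    using sprod_unit[OF x id_closed[unfolded One_nat_def], of \<gamma>] x by (simp_all add: unit_coeff_id)
next
  let ?A = "shuffle_algebra_of K P"
  fix \<gamma> \<delta> \<sigma> \<rho> :: "nat \<Rightarrow> nat" and n m r x y z
  assume sh: "\<gamma> \<in> Sh [n, m + r]" "\<delta> \<in> Sh [m, r]" "\<sigma> \<in> Sh [n, m]" "\<rho> \<in> Sh [n + m, r]"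
    and eq: "\<gamma> \<circ> perm_times n (m + r) id \<delta> = \<rho> \<circ> perm_times (n + m) r \<sigma> id"
    and "x \<in> carrier (scomp ?A n)" "y \<in> carrier (scomp ?A m)" "z \<in> carrier (scomp ?A r)"
  then have x: "x \<in> carrier (pcomp P (n + 1))" and y: "y \<in> carrier (pcomp P (m + 1))"
    and z: "z \<in> carrier (pcomp P (r + 1))" by simp_all
  have perm_id: "perm_times a b id id = id" for a b by (auto simp: perm_times_def)
  \<comment> \<open>A factor of degree 0 is a scalar. Its empty block forces two of the four
    shuffles to be the identity, so \<open>eq\<close> equates the other two, and the claim becomes
    linearity of one product.\<close>
  consider "n = 0" | "m = 0" | "r = 0" | "n \<noteq> 0" "m \<noteq> 0" "r \<noteq> 0" by blast
  then show "sprod ?A n (m + r) \<gamma> x (sprod ?A m r \<delta> y z) =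
      sprod ?A (n + m) r \<rho> (sprod ?A n m \<sigma> x y) z"
  proof cases
    case 1
    have "\<delta> permutes {1..m + r}" using sh by (simp add: Sh2_iff)
    then have "perm_times 0 (m + r) id \<delta> = \<delta>"
      using permutes_not_in by (force simp: perm_times_def)
    then have "\<rho> = \<delta>"
      using eq sh Sh2_zero_left[of \<gamma> "m + r"] Sh2_zero_left[of \<sigma> m] 1 by (simp add: perm_id)
    moreover have u: "x \<in> carrier (pcomp P (Suc 0))" using x 1 by simp
    ultimately show ?thesis
      using sprod_unit(1)[OF sprod_closed[OF sh(2) y z] u] sprod_unit(1)[OF y u]
        sprod_smult(1)[OF sh(2) y z unit_coeff_closed(1)[OF u]] 1 by simp
  next
    case 2
    then have "\<rho> = \<gamma>"
      using eq sh Sh2_zero_left[of \<delta> r] Sh2_zero_right[of \<sigma> n] by (simp add: perm_id)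
    moreover have u: "y \<in> carrier (pcomp P (Suc 0))" using y 2 by simp
    moreover have "\<gamma> \<in> Sh [n, r]" using sh(1) 2 by simp
    ultimately show ?thesis
      using sprod_unit(1)[OF z u] sprod_unit(2)[OF x u]
        sprod_smult[OF _ x z unit_coeff_closed(1)[OF u], of \<gamma>] 2 by simp
  next
    case 3
    have "\<sigma> permutes {1..n + m}" using sh by (simp add: Sh2_iff)
    then have "perm_times (n + m) 0 \<sigma> id = \<sigma>"
      using permutes_not_in by (force simp: perm_times_def)
    then have "\<gamma> = \<sigma>"
      using eq sh Sh2_zero_right[of \<rho> "n + m"] Sh2_zero_right[of \<delta> m] 3 by (simp add: perm_id)
    moreover have u: "z \<in> carrier (pcomp P (Suc 0))" using z 3 by simp
    ultimately show ?thesis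
      using sprod_unit(2)[OF sprod_closed[OF sh(3) x y] u] sprod_unit(2)[OF y u]
        sprod_smult(2)[OF sh(3) x y unit_coeff_closed(1)[OF u]] 3 by simp
  next
    case 4
    then show ?thesis
      using gamma_shuffle_assoc[OF sh eq 4 x y z] by (simp add: sprod_shuffle_algebra_of)
  qed
qed

end

section \<open>\<Gamma> is determined by its partial operations\<close>

context permutad
begin

text \<open>The fibres of a surjection are nonempty, so the product is a value of \<Gamma> and not a
  scalar multiple; its surjection is \<open>t\<close> again by
  \<open>shuffle_sur_shuffle_of\<close>.\<close>

lemma set_prod_shuffle_algebra_of:
  assumes "t \<in> Sur n 2"
  shows "set_prod (shuffle_algebra_of K P) (fibre n t 1) (fibre n t 2) x y = pgamma P n 2 t [x, y]"
proof -
  have "card (fibre n t 1) \<noteq> 0" "card (fibre n t 2) \<noteq> 0"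
    using card_fibre_pos[OF assms, of 1] card_fibre_pos[OF assms, of 2] by auto
  then show ?thesis
    unfolding set_prod_def sprod_shuffle_algebra_of(3) shuffle_of_two[OF assms, symmetric]
    by (simp only: sprod_shuffle_algebra_of(3) shuffle_sur_shuffle_of[OF assms]
        Sur2_fibres(2)[OF assms] not_False_eq_True)
qed

text \<open>Induction on \<open>k\<close> from the corolla at \<open>k = 1\<close>. Splitting off
  the value 1 of \<open>t\<close> matches the recursion of \<open>labelled_prod\<close>, whose
  outermost set product is \<Gamma> at a surjection onto \<open>{1..2}\<close>.\<close>

theorem gamma_eq_labelled_prod:
  assumes "1 \<le> k" "t \<in> Sur n k" "ls \<in> gamma_args P n k t"
  shows "pgamma P n k t ls =
    labelled_prod (shuffle_algebra_of K P) (zip (map (fibre n t) [1..<Suc k]) ls)"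
  using assms
proof (induction k arbitrary: n t ls rule: nat_induct_at_least)
  case base
  interpret A: shuffle_algebra K "shuffle_algebra_of K P"
    by (rule shuffle_algebra_shuffle_algebra_of)
  have t: "t = corolla n" by (rule Sur_one[OF base(1)])
  obtain x where ls: "ls = [x]"
    using gamma_args_length[OF base(2)] by (auto simp: length_Suc_conv)
  have x: "x \<in> carrier (pcomp P (n + 1))"
    using base(2) by (simp only: ls t gamma_args_corolla)
  have "n \<ge> 1" using Sur_le[OF base(1)] .
  then have "pgamma P n 1 t ls = x" using gamma_corolla x ls t by simp
  moreover have "labelled_prod (shuffle_algebra_of K P) [({1..n}, x)] = x"
    using x by (intro A.labelled_prod_single) simp_all
  ultimately show ?case
    using fibre_corolla[of n] by (simp add: ls t del: labelled_prod.simps)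
next
  case (Suc k)
  interpret A: shuffle_algebra K "shuffle_algebra_of K P"
    by (rule shuffle_algebra_shuffle_algebra_of)
  let ?A = "shuffle_algebra_of K P"
  note t = Suc.prems(1)
  obtain x l where ls: "ls = x # l" "length l = k"
    using gamma_args_length[OF Suc.prems(2)] by (auto simp: length_Suc_conv)
  \<comment> \<open>\<open>t\<close> is the substitution of a corolla and \<open>v\<close> into \<open>u\<close>: \<open>u\<close> separates the value 1 from the others, \<open>v\<close> is
    the standardisation of \<open>t - 1\<close> on the remaining points.\<close>
  define u where "u = (\<lambda>a\<in>{1..n}. if t a = 1 then 1 else 2 :: nat)"
  have tpos: "t a \<in> {1..Suc k}" if "a \<in> {1..n}" for a using SurD(1)[OF t that] .
  have u1: "fibre n u 1 = fibre n t 1" by (auto simp: fibre_def u_def)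
  have u2: "fibre n u 2 = {a \<in> {1..n}. t a \<noteq> 1}" by (auto simp: fibre_def u_def)
  define c where "c = card (fibre n u 2)"
  define v where "v = (\<lambda>b\<in>{1..c}. t (enum_of (fibre n u 2) b) - 1)"
  let ?e = "enum_of (fibre n u 2)"
  have e: "?e b \<in> {1..n} \<and> t (?e b) \<noteq> 1" if "b \<in> {1..c}" for b
    using enum_of_in[OF finite_fibre that[unfolded c_def]] u2 by blast
  \<comment> \<open>The enumeration of the remaining points undoes the standardisation; the shift by
    one returns from \<open>v\<close> to \<open>t\<close>.\<close>
  have fv: "?e ` fibre c v j = fibre n t (Suc j)" if "j \<ge> 1" for j
  proof (intro equalityI subsetI)
    fix a assume "a \<in> ?e ` fibre c v j"
    then obtain b where b: "b \<in> {1..c}" "v b = j" "a = ?e b" by (auto simp: fibre_def)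
    then show "a \<in> fibre n t (Suc j)" using e[OF b(1)] tpos[of "?e b"] by (auto simp: fibre_def v_def)
  next
    fix a assume "a \<in> fibre n t (Suc j)"
    then have a: "a \<in> {1..n}" "t a = Suc j" by (auto simp: fibre_def)
    then have af: "a \<in> fibre n u 2" using that by (simp add: u2)
    then have "a = ?e (rank_in (fibre n u 2) a)" "rank_in (fibre n u 2) a \<in> {1..c}"
      using enum_of_rank_in rank_in_bounds unfolding c_def by (metis finite_fibre)+
    moreover from this have "v (rank_in (fibre n u 2) a) = j" using a by (simp add: v_def)
    ultimately show "a \<in> ?e ` fibre c v j" unfolding fibre_def by blast
  qed
  have card_fv: "card (fibre c v j) = card (fibre n t (Suc j))" if "j \<ge> 1" for j
  proof -
    have "inj_on ?e (fibre c v j)"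
      by (rule inj_on_subset[OF strict_mono_on_imp_inj_on[OF strict_mono_on_enum_of]])
        (use fibre_subset c_def in blast)
    then show ?thesis using fv[OF that] card_image by metis
  qed
  have v: "v \<in> Sur c k"
  proof (rule SurI)
    fix b assume b: "b \<in> {1..c}"
    then show "v b \<in> {1..k}" using e[OF b] tpos[of "?e b"] by (auto simp: v_def)
  next
    fix j assume j: "j \<in> {1..k}"
    then have "fibre n t (Suc j) \<noteq> {}" by (intro SurD(2)[OF t]) simp
    then have "fibre c v j \<noteq> {}" using fv[of j] j by auto
    then show "\<exists>b\<in>{1..c}. v b = j" by (auto simp: fibre_def)
  qed (auto simp: v_def)
  \<comment> \<open>The value 2 is attained because the induction starts at 1; this makes the second
    fibre of \<open>u\<close> nonempty.\<close>
  have ne: "fibre n t 1 \<noteq> {}" "fibre n t 2 \<noteq> {}" using SurD(2)[OF t] Suc.hyps by auto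
  have u: "u \<in> Sur n 2"
  proof (rule SurI)
    fix j assume "j \<in> {1..2::nat}"
    then have "j = 1 \<or> j = 2" by auto
    moreover have "fibre n u 1 \<noteq> {}" "fibre n u 2 \<noteq> {}"
      using ne unfolding u1 u2 by (auto simp: fibre_def)
    ultimately show "\<exists>a\<in>{1..n}. u a = j" by (auto simp: fibre_def)
  qed (auto simp: u_def)
  have all: "list_all2 (\<lambda>x j. x \<in> carrier (pcomp P (card (fibre n t j) + 1))) (x # l)
      (1 # map Suc [1..<Suc k])"
    using Suc.prems(2) unfolding gamma_args_iff ls map_Suc_upt by (simp add: upt_conv_Cons del: upt_Suc)
  then have x: "x \<in> carrier (pcomp P (card (fibre n t 1) + 1))" by simp
  have "list_all2 (\<lambda>x j. x \<in> carrier (pcomp P (card (fibre n t (Suc j)) + 1))) l [1..<Suc k]"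
    using all by (simp add: list_all2_map2 del: upt_Suc)
  then have l: "l \<in> gamma_args P c k v"
    unfolding gamma_args_iff
    by (rule list.rel_mono_strong) (use card_fv in \<open>auto simp del: upt_Suc\<close>)
  have ne1: "card (fibre n t 1) \<noteq> 0" using ne by simp
  have subst: "subst_two n u 1 (corolla (card (fibre n t 1))) v = t"
  proof
    fix a
    show "subst_two n u 1 (corolla (card (fibre n t 1))) v a = t a"
    proof (cases "a \<in> {1..n}")
      case True
      show ?thesis
      proof (cases "t a = 1")
        case True
        then have af: "a \<in> fibre n t 1" using \<open>a \<in> {1..n}\<close> by (simp add: fibre_def)
        have "rank_in (fibre n t 1) a \<in> {1..card (fibre n t 1)}"
          by (rule rank_in_bounds[OF finite_fibre af])
        then show ?thesis
          using True \<open>a \<in> {1..n}\<close> u1 by (simp add: subst_two_def u_def corolla_def)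
      next
        case False
        then have af: "a \<in> fibre n u 2" using \<open>a \<in> {1..n}\<close> u2 by simp
        then have "?e (rank_in (fibre n u 2) a) = a" "rank_in (fibre n u 2) a \<in> {1..c}"
          using enum_of_rank_in rank_in_bounds unfolding c_def by (metis finite_fibre)+
        then have "v (rank_in (fibre n u 2) a) = t a - 1" by (simp only: v_def restrict_apply if_True)
        moreover have "u a \<noteq> 1" using False \<open>a \<in> {1..n}\<close> by (simp add: u_def)
        ultimately show ?thesis using \<open>a \<in> {1..n}\<close> tpos[of a] by (simp add: subst_two_def)
      qed
    next
      case False
      then show ?thesis using SurD(3)[OF t False] by (simp only: subst_two_def restrict_apply if_False)
    qed
  qed
  have "pgamma P n (1 + k) (subst_two n u 1 (corolla (card (fibre n t 1))) v) ([x] @ l) =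
      pgamma P n 2 u [pgamma P (card (fibre n t 1)) 1 (corolla (card (fibre n t 1))) [x],
        pgamma P c k v l]"
    using gamma_subst_two[OF u, of "corolla (card (fibre n t 1))" 1 v k "[x]" l]
      corolla_in_Sur[OF ne1] v l x
    unfolding u1 gamma_args_corolla c_def[symmetric] by blast
  also have "pgamma P (card (fibre n t 1)) 1 (corolla (card (fibre n t 1))) [x] = x"
    by (rule gamma_corolla[OF _ x]) (use ne1 in linarith)
  also have "pgamma P c k v l = labelled_prod ?A (zip (map (fibre c v) [1..<Suc k]) l)"
    by (rule Suc.IH[OF v l])
  \<comment> \<open>The induction hypothesis labels by subsets of \<open>{1..c}\<close>. Relabelling
    along \<open>?e\<close> puts the labels back inside \<open>{1..n}\<close>, where they are fibres
    of \<open>t\<close>.\<close>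
  also have "\<dots> = labelled_prod ?A (map (apfst ((`) ?e)) (zip (map (fibre c v) [1..<Suc k]) l))"
  proof (rule A.labelled_prod_relabel[symmetric])
    have "list_all2 (\<lambda>x j. x \<in> carrier (scomp ?A (card (fibre c v j)))) l [1..<Suc k]"
      using l by (simp add: gamma_args_iff del: upt_Suc)
    note lab = labelled_gamma_args[OF v this]
    show "labelled ?A (zip (map (fibre c v) [1..<Suc k]) l)" by (rule lab)
    show "strict_mono_on (labels (zip (map (fibre c v) [1..<Suc k]) l)) ?e"
      unfolding lab(2) unfolding c_def by (rule strict_mono_on_enum_of)
  qed
  also have "map (apfst ((`) ?e)) (zip (map (fibre c v) [1..<Suc k]) l) =
      zip (map (fibre n t) (map Suc [1..<Suc k])) l"
  proof -
    have "map (apfst ((`) ?e)) (zip (map (fibre c v) [1..<Suc k]) l) =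
        zip (map (\<lambda>j. ?e ` fibre c v j) [1..<Suc k]) l"
      by (simp add: zip_map1 apfst_def map_prod_def case_prod_unfold comp_def del: upt_Suc)
    also have "map (\<lambda>j. ?e ` fibre c v j) [1..<Suc k] = map (\<lambda>j. fibre n t (Suc j)) [1..<Suc k]"
      by (rule map_cong) (use fv in \<open>auto simp del: upt_Suc\<close>)
    finally show ?thesis by (simp add: comp_def del: upt_Suc)
  qed
  finally have "pgamma P n (Suc k) t ls = pgamma P n 2 u
      [x, labelled_prod ?A (zip (map (fibre n t) (map Suc [1..<Suc k])) l)]"
    unfolding subst ls by simp
  moreover have "labels (zip (map (fibre n t) (map Suc [1..<Suc k])) l) = fibre n u 2"
  proof -
    have "list_all2 (\<lambda>x j. x \<in> carrier (scomp ?A (card (fibre n t j)))) l (map Suc [1..<Suc k])"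
      using all by (simp del: upt_Suc)
    then have "labels (zip (map (fibre n t) (map Suc [1..<Suc k])) l) =
        (\<Union>j\<in>set (map Suc [1..<Suc k]). fibre n t j)"
      using labelled_zip_fibres by (metis distinct_map distinct_upt inj_Suc inj_on_subset subset_UNIV)
    also have "set (map Suc [1..<Suc k]) = {2..Suc k}" unfolding map_Suc_upt by auto
    also have "(\<Union>j\<in>{2..Suc k}. fibre n t j) = fibre n u 2"
    proof -
      have "t a \<in> {2..Suc k} \<longleftrightarrow> t a \<noteq> 1" if "a \<in> {1..n}" for a
        using tpos[OF that] by auto
      then show ?thesis unfolding u2 by (auto simp only: fibre_def)
    qed
    finally show ?thesis .
  qed
  moreover have "[1..<Suc (Suc k)] = 1 # map Suc [1..<Suc k]"
    by (simp add: map_Suc_upt upt_conv_Cons del: upt_Suc)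
  ultimately show ?case
    using set_prod_shuffle_algebra_of[OF u] u1 by (simp add: ls del: upt_Suc)
qed

lemma identified_shuffle_algebra_of: "identified P (shuffle_algebra_of K P)"
proof -
  have "partial_op P m n t \<mu> \<nu> = sprod (shuffle_algebra_of K P) n m (shuffle_of (m + n) 2 t) \<nu> \<mu>"
    if t: "t \<in> Sur (m + n) 2" and n: "n = card (fibre (m + n) t 1)" for m n t \<mu> \<nu>
  proof -
    have "m = card (fibre (m + n) t 2)" using Sur2_fibres(2)[OF t] n by simp
    then show ?thesis
      using set_prod_shuffle_algebra_of[OF t, of \<nu> \<mu>] n
      by (simp add: partial_op_def set_prod_def shuffle_of_two[OF t])
  qed
  then show ?thesis by (simp add: identified_def)
qed

end

section \<open>The round trip on shuffle algebras\<close>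

lemma (in shuffle_algebra) labelled_prod_two:
  assumes "finite S" "finite T" "S \<inter> T = {}" "x \<in> carrier (scomp A (card S))"
    "y \<in> carrier (scomp A (card T))"
  shows "labelled_prod A [(S, x), (T, y)] = set_prod A S T x y"
  using assms set_prod_one_right by simp

lemma (in shuffle_algebra) gamma_permutad_of_two:
  assumes "t \<in> Sur n 2" "x \<in> carrier (scomp A (card (fibre n t 1)))"
    "y \<in> carrier (scomp A (card (fibre n t 2)))"
  shows "pgamma (permutad_of A) n 2 t [x, y] =
    sprod A (card (fibre n t 1)) (card (fibre n t 2)) (shuffle_of n 2 t) x y"
  using labelled_prod_two[OF finite_fibre finite_fibre _ assms(2,3)] fibre_disjoint[of 1 2 n t]
  unfolding permutad_of_simps upt_two shuffle_of_two[OF assms(1)] set_prod_def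
  by simp

lemma (in shuffle_algebra) identified_permutad_of: "identified (permutad_of A) A"
proof -
  have "partial_op (permutad_of A) m n t \<mu> \<nu> = sprod A n m (shuffle_of (m + n) 2 t) \<nu> \<mu>"
    if t: "t \<in> Sur (m + n) 2" and n: "n = card (fibre (m + n) t 1)"
      and "\<mu> \<in> carrier (scomp A m)" "\<nu> \<in> carrier (scomp A n)" for m n t \<mu> \<nu>
  proof -
    have m: "m = card (fibre (m + n) t 2)" using Sur2_fibres(2)[OF t] n by simp
    show ?thesis
      using gamma_permutad_of_two[OF t, of \<nu> \<mu>] that(3,4)
      unfolding partial_op_def n[symmetric] m[symmetric] by blast
  qed
  then show ?thesis by (simp add: identified_def)
qed

text \<open>With a factor of degree 0, bilinearity and the unit laws force the product of
  \<open>A\<close> itself to be scalar multiplication. Otherwise passing from \<gamma> to its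
  surjection and back returns \<gamma>.\<close>

lemma (in shuffle_algebra) sprod_shuffle_algebra_of_permutad_of:
  assumes "\<gamma> \<in> Sh [n, m]" "x \<in> carrier (scomp A n)" "y \<in> carrier (scomp A m)"
  shows "sprod (shuffle_algebra_of K (permutad_of A)) n m \<gamma> x y = sprod A n m \<gamma> x y"
proof -
  interpret P: permutad K "permutad_of A" by (rule permutad_permutad_of)
  interpret M: module K "scomp A n" by (rule comp_module)
  interpret N: module K "scomp A m" by (rule comp_module)
  have bil: "bilinear_map K (scomp A n) (scomp A m) (scomp A (n + m)) (sprod A n m \<gamma>)"
    by (rule prod_bilinear[OF assms(1)])
  consider "n = 0" | "m = 0" | "n \<noteq> 0" "m \<noteq> 0" by blast
  then show ?thesis
  proof cases
    case 1
    let ?c = "unit_coeff K (permutad_of A) x"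
    have c: "?c \<in> carrier K" "?c \<odot>\<^bsub>scomp A 0\<^esub> sone A = x"
      using P.unit_coeff_closed[of x] assms 1 by simp_all
    have "sprod A 0 m \<gamma> (?c \<odot>\<^bsub>scomp A 0\<^esub> sone A) y = ?c \<odot>\<^bsub>scomp A m\<^esub> sprod A 0 m \<gamma> (sone A) y"
      using bil 1 c(1) one_closed assms(3) by (simp add: bilinear_map_def linear_map_def)
    then show ?thesis
      using c one_left assms 1 P.sprod_unit(1)[of y m x \<gamma>] by simp
  next
    case 2
    let ?c = "unit_coeff K (permutad_of A) y"
    have c: "?c \<in> carrier K" "?c \<odot>\<^bsub>scomp A 0\<^esub> sone A = y"
      using P.unit_coeff_closed[of y] assms 2 by simp_all
    have "sprod A n 0 \<gamma> x (?c \<odot>\<^bsub>scomp A 0\<^esub> sone A) = ?c \<odot>\<^bsub>scomp A n\<^esub> sprod A n 0 \<gamma> x (sone A)"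
      using bil 2 c(1) one_closed assms(2) by (simp add: bilinear_map_def linear_map_def)
    then show ?thesis
      using c one_right assms 2 P.sprod_unit(2)[of x n y \<gamma>] by simp
  next
    case 3
    let ?t = "shuffle_sur n m \<gamma>"
    note f = fibres_shuffle_sur[OF assms(1)]
    have s: "?t \<in> Sur (n + m) 2" by (rule shuffle_sur_in_Sur[OF assms(1) 3])
    have "shuffle_of (n + m) 2 ?t = \<gamma>"
      unfolding shuffle_of_two[OF s] f by (rule shuffle_sets_blocks[OF assms(1)])
    then show ?thesis
      using gamma_permutad_of_two[OF s, of x y] assms(2,3) 3
      unfolding f sprod_shuffle_algebra_of(3)[OF 3] by (simp del: permutad_of_simps)
  qed
qed

section \<open>The equivalence\<close>

lemma linear_mapD: "linear_map K M N f \<Longrightarrow> x \<in> carrier M \<Longrightarrow> f x \<in> carrier N"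
  by (auto simp: linear_map_def)

lemma linear_map_restrict_id: "module K M \<Longrightarrow> linear_map K M M (\<lambda>x\<in>carrier M. x)"
  by (rule linear_map_cong[where f = "\<lambda>x. x"]) (auto simp: linear_map_def)

lemma linear_map_restrict_compose:
  assumes "linear_map K M N f" "linear_map K N L g" "module K M"
  shows "linear_map K M L (compose (carrier M) g f)"
  by (rule linear_map_cong[OF linear_map_compose[OF assms(1,2)] assms(3)]) (simp add: compose_eq)

lemma permutad_homI:
  assumes "f \<in> extensional {1..}" "\<And>n. n \<ge> 1 \<Longrightarrow> f n \<in> extensional (carrier (pcomp P n))"
    and "\<And>n. n \<ge> 1 \<Longrightarrow> linear_map K (pcomp P n) (pcomp Q n) (f n)"
    and "f 1 (pid P) = pid Q"
    and "\<And>n k t ls. 1 \<le> k \<Longrightarrow> t \<in> Sur n k \<Longrightarrow> ls \<in> gamma_args P n k t \<Longrightarrow>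
      f (n + 1) (pgamma P n k t ls) = pgamma Q n k t (map2 f (input_arities n k t) ls)"
  shows "f \<in> permutad_hom K P Q"
  using assms unfolding permutad_hom_def by blast

lemma permutad_homD:
  assumes "f \<in> permutad_hom K P Q"
  shows "f \<in> extensional {1..}" "n \<ge> 1 \<Longrightarrow> f n \<in> extensional (carrier (pcomp P n))"
    and "n \<ge> 1 \<Longrightarrow> linear_map K (pcomp P n) (pcomp Q n) (f n)"
    and "f 1 (pid P) = pid Q"
    and "1 \<le> k \<Longrightarrow> t \<in> Sur n k \<Longrightarrow> ls \<in> gamma_args P n k t \<Longrightarrow>
      f (n + 1) (pgamma P n k t ls) = pgamma Q n k t (map2 f (input_arities n k t) ls)"
  using assms Sur_le[of t n k] unfolding permutad_hom_def by blast+

lemma shuffle_algebra_homI: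
  assumes "\<And>n. f n \<in> extensional (carrier (scomp A n))"
    and "\<And>n. linear_map K (scomp A n) (scomp B n) (f n)"
    and "f 0 (sone A) = sone B"
    and "\<And>n m \<gamma> x y. \<gamma> \<in> Sh [n, m] \<Longrightarrow> x \<in> carrier (scomp A n) \<Longrightarrow> y \<in> carrier (scomp A m) \<Longrightarrow>
      f (n + m) (sprod A n m \<gamma> x y) = sprod B n m \<gamma> (f n x) (f m y)"
  shows "f \<in> shuffle_algebra_hom K A B"
  using assms unfolding shuffle_algebra_hom_def by blast

lemma shuffle_algebra_homD:
  assumes "f \<in> shuffle_algebra_hom K A B"
  shows "f n \<in> extensional (carrier (scomp A n))"
    and "linear_map K (scomp A n) (scomp B n) (f n)"
    and "f 0 (sone A) = sone B"
    and "\<gamma> \<in> Sh [n, m] \<Longrightarrow> x \<in> carrier (scomp A n) \<Longrightarrow> y \<in> carrier (scomp A m) \<Longrightarrow>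
      f (n + m) (sprod A n m \<gamma> x y) = sprod B n m \<gamma> (f n x) (f m y)"
  using assms unfolding shuffle_algebra_hom_def by blast+

lemma gamma_args_nth:
  "ls \<in> gamma_args P n k t \<longleftrightarrow> length ls = length (input_arities n k t) \<and>
     (\<forall>i<length ls. ls ! i \<in> carrier (pcomp P (input_arities n k t ! i)))"
  by (auto simp: gamma_args_def tuples_def list_all2_conv_all_nth)

lemma input_arities_pos: "i < length (input_arities n k t) \<Longrightarrow> input_arities n k t ! i \<ge> 1"
  by (simp add: input_arities_def del: upt_Suc)

lemma gamma_args_map2:
  assumes "ls \<in> gamma_args P n k t" "\<And>j. j \<ge> 1 \<Longrightarrow> linear_map K (pcomp P j) (pcomp Q j) (f j)"
  shows "map2 f (input_arities n k t) ls \<in> gamma_args Q n k t"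
  using assms linear_mapD[OF assms(2)] input_arities_pos[of _ n k t] by (auto simp: gamma_args_nth)

lemma map2_restrict_id:
  assumes "ls \<in> gamma_args P n k t"
  shows "map2 (\<lambda>n\<in>{1..}. \<lambda>x\<in>carrier (pcomp P n). x) (input_arities n k t) ls = ls"
  using assms input_arities_pos[of _ n k t]
  by (intro nth_equalityI) (auto simp: gamma_args_nth)

lemma map2_restrict_compose:
  assumes "ls \<in> gamma_args P n k t"
  shows "map2 (\<lambda>n\<in>{1..}. compose (carrier (pcomp P n)) (g n) (f n)) (input_arities n k t) ls =
    map2 g (input_arities n k t) (map2 f (input_arities n k t) ls)"
  using assms input_arities_pos[of _ n k t]
  by (intro nth_equalityI) (auto simp: gamma_args_nth compose_eq)

text \<open>Formulated for two records that may differ outside the meaningful arguments, so that it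
  yields the components of the natural isomorphism as well as the identity morphisms.\<close>

lemma restrict_id_in_permutad_hom:
  assumes "permutad K P" "\<And>n. n \<ge> 1 \<Longrightarrow> pcomp Q n = pcomp P n" "pid Q = pid P"
    and gamma: "\<And>n k t ls. 1 \<le> k \<Longrightarrow> t \<in> Sur n k \<Longrightarrow> ls \<in> gamma_args P n k t \<Longrightarrow>
      pgamma Q n k t ls = pgamma P n k t ls"
  shows "(\<lambda>n\<in>{1..}. \<lambda>x\<in>carrier (pcomp P n). x) \<in> permutad_hom K P Q"
proof -
  interpret permutad K P by fact
  show ?thesis
  proof (rule permutad_homI)
    fix n k t ls assume *: "1 \<le> k" "t \<in> Sur n k" "ls \<in> gamma_args P n k t"
    then show "(\<lambda>n\<in>{1..}. \<lambda>x\<in>carrier (pcomp P n). x) (n + 1) (pgamma P n k t ls) =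
        pgamma Q n k t (map2 (\<lambda>n\<in>{1..}. \<lambda>x\<in>carrier (pcomp P n). x) (input_arities n k t) ls)"
      unfolding map2_restrict_id[OF *(3)] using gamma_closed[OF *] gamma[OF *] by simp
  qed (use assms(2,3) id_closed comp_module in \<open>simp_all add: linear_map_restrict_id\<close>)
qed

lemma restrict_id_in_shuffle_algebra_hom:
  assumes "shuffle_algebra K A" "\<And>n. scomp B n = scomp A n" "sone B = sone A"
    and prod: "\<And>n m \<gamma> x y. \<gamma> \<in> Sh [n, m] \<Longrightarrow> x \<in> carrier (scomp A n) \<Longrightarrow> y \<in> carrier (scomp A m) \<Longrightarrow>
      sprod B n m \<gamma> x y = sprod A n m \<gamma> x y"
  shows "(\<lambda>n. \<lambda>x\<in>carrier (scomp A n). x) \<in> shuffle_algebra_hom K A B"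
proof -
  interpret shuffle_algebra K A by fact
  show ?thesis
  proof (rule shuffle_algebra_homI)
    fix n m \<gamma> x y
    assume *: "\<gamma> \<in> Sh [n, m]" "x \<in> carrier (scomp A n)" "y \<in> carrier (scomp A m)"
    have "sprod A n m \<gamma> x y \<in> carrier (scomp A (n + m))"
      using prod_bilinear[OF *(1)] *(2,3) by (auto simp: bilinear_map_def linear_map_def)
    then show "(\<lambda>x\<in>carrier (scomp A (n + m)). x) (sprod A n m \<gamma> x y) =
        sprod B n m \<gamma> ((\<lambda>x\<in>carrier (scomp A n). x) x) ((\<lambda>x\<in>carrier (scomp A m). x) y)"
      using * prod[OF *] by simp
  qed (use assms(2,3) one_closed comp_module in \<open>simp_all add: linear_map_restrict_id\<close>)
qed

lemma category_permutad_cat: "category (permutad_cat K)"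
proof
  fix X assume "X \<in> cat_ob (permutad_cat K)"
  then show "cat_id (permutad_cat K) X \<in> cat_hom (permutad_cat K) X X"
    unfolding permutad_cat_def cat_data.simps
    by (intro restrict_id_in_permutad_hom) auto
next
  fix X Y Z f g
  assume "X \<in> cat_ob (permutad_cat K)" "f \<in> cat_hom (permutad_cat K) X Y"
    "g \<in> cat_hom (permutad_cat K) Y Z"
  then have X: "permutad K X" and f: "f \<in> permutad_hom K X Y" and g: "g \<in> permutad_hom K Y Z"
    by (simp_all add: permutad_cat_def)
  interpret permutad K X by fact
  note fD = permutad_homD[OF f] and gD = permutad_homD[OF g]
  have "(\<lambda>n\<in>{1..}. compose (carrier (pcomp X n)) (g n) (f n)) \<in> permutad_hom K X Z"
  proof (rule permutad_homI)
    fix n k t ls assume *: "1 \<le> k" "t \<in> Sur n k" "ls \<in> gamma_args X n k t"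
    then show "(\<lambda>n\<in>{1..}. compose (carrier (pcomp X n)) (g n) (f n)) (n + 1) (pgamma X n k t ls) =
        pgamma Z n k t (map2 (\<lambda>n\<in>{1..}. compose (carrier (pcomp X n)) (g n) (f n))
          (input_arities n k t) ls)"
      unfolding map2_restrict_compose[OF *(3)]
      using gD(5)[OF *(1,2) gamma_args_map2[OF *(3) fD(3)]] fD(5)[OF *] gamma_closed[OF *]
      by (simp add: compose_eq)
  next
    show "linear_map K (pcomp X n) (pcomp Z n)
        ((\<lambda>n\<in>{1..}. compose (carrier (pcomp X n)) (g n) (f n)) n)" if "n \<ge> 1" for n
      using linear_map_restrict_compose[OF fD(3) gD(3) comp_module, OF that that that] that by simp
  qed (use fD(4) gD(4) id_closed in \<open>simp_all add: compose_eq\<close>)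
  then show "cat_comp (permutad_cat K) X Y Z g f \<in> cat_hom (permutad_cat K) X Z"
    by (simp add: permutad_cat_def)
next
  fix X Y f
  assume "f \<in> cat_hom (permutad_cat K) X Y"
  then have f: "f \<in> permutad_hom K X Y" by (simp add: permutad_cat_def)
  have "f n \<in> carrier (pcomp X n) \<rightarrow> carrier (pcomp Y n)" if "n \<ge> 1" for n
    using permutad_homD(3)[OF f that] by (simp add: linear_map_def)
  note fD = permutad_homD(1,2)[OF f] this
  \<comment> \<open>The unit laws are equations between total functions; they hold because
    \<open>f\<close> is extensional in the arity and on each carrier.\<close>
  show "cat_comp (permutad_cat K) X X Y f (cat_id (permutad_cat K) X) = f"
    unfolding permutad_cat_def cat_data.simps
    by (rule extensionalityI[OF _ fD(1)]) (use fD in \<open>auto intro!: compose_Id\<close>)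
  show "cat_comp (permutad_cat K) X Y Y (cat_id (permutad_cat K) Y) f = f"
    unfolding permutad_cat_def cat_data.simps
    by (rule extensionalityI[OF _ fD(1)]) (use fD in \<open>auto intro!: Id_compose\<close>)
next
  fix W X Y Z f g h
  assume "f \<in> cat_hom (permutad_cat K) W X"
  then have "f \<in> permutad_hom K W X" by (simp add: permutad_cat_def)
  then have "f n \<in> carrier (pcomp W n) \<rightarrow> carrier (pcomp X n)" if "n \<ge> 1" for n
    using permutad_homD(3) that by (fastforce simp: linear_map_def)
  then show "cat_comp (permutad_cat K) W Y Z h (cat_comp (permutad_cat K) W X Y g f) =
      cat_comp (permutad_cat K) W X Z (cat_comp (permutad_cat K) X Y Z h g) f"
    unfolding permutad_cat_def cat_data.simps
    by (intro restrict_ext) (simp add: compose_assoc)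
qed

lemma category_shuffle_algebra_cat: "category (shuffle_algebra_cat K)"
proof
  fix X assume "X \<in> cat_ob (shuffle_algebra_cat K)"
  then show "cat_id (shuffle_algebra_cat K) X \<in> cat_hom (shuffle_algebra_cat K) X X"
    by (simp add: shuffle_algebra_cat_def restrict_id_in_shuffle_algebra_hom)
next
  fix X Y Z f g
  assume "X \<in> cat_ob (shuffle_algebra_cat K)" "f \<in> cat_hom (shuffle_algebra_cat K) X Y"
    "g \<in> cat_hom (shuffle_algebra_cat K) Y Z"
  then have X: "shuffle_algebra K X" and f: "f \<in> shuffle_algebra_hom K X Y"
    and g: "g \<in> shuffle_algebra_hom K Y Z"
    by (simp_all add: shuffle_algebra_cat_def)
  interpret shuffle_algebra K X by fact
  note fD = shuffle_algebra_homD[OF f] and gD = shuffle_algebra_homD[OF g]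
  have "(\<lambda>n. compose (carrier (scomp X n)) (g n) (f n)) \<in> shuffle_algebra_hom K X Z"
  proof (rule shuffle_algebra_homI)
    fix n m \<gamma> x y
    assume *: "\<gamma> \<in> Sh [n, m]" "x \<in> carrier (scomp X n)" "y \<in> carrier (scomp X m)"
    have "sprod X n m \<gamma> x y \<in> carrier (scomp X (n + m))"
      using prod_bilinear[OF *(1)] *(2,3) by (auto simp: bilinear_map_def linear_map_def)
    then show "compose (carrier (scomp X (n + m))) (g (n + m)) (f (n + m)) (sprod X n m \<gamma> x y) =
        sprod Z n m \<gamma> (compose (carrier (scomp X n)) (g n) (f n) x)
          (compose (carrier (scomp X m)) (g m) (f m) y)"
      using gD(4)[OF *(1) linear_mapD[OF fD(2) *(2)] linear_mapD[OF fD(2) *(3)]] fD(4)[OF *] *(2,3)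
      by (simp add: compose_eq)
  qed (use fD(3) gD(3) one_closed in
      \<open>simp_all add: linear_map_restrict_compose[OF fD(2) gD(2) comp_module] compose_eq\<close>)
  then show "cat_comp (shuffle_algebra_cat K) X Y Z g f \<in> cat_hom (shuffle_algebra_cat K) X Z"
    by (simp add: shuffle_algebra_cat_def)
next
  fix X Y f
  assume "f \<in> cat_hom (shuffle_algebra_cat K) X Y"
  then have f: "f \<in> shuffle_algebra_hom K X Y" by (simp add: shuffle_algebra_cat_def)
  have "f n \<in> carrier (scomp X n) \<rightarrow> carrier (scomp Y n)" for n
    using shuffle_algebra_homD(2)[OF f] by (simp add: linear_map_def)
  note fD = shuffle_algebra_homD(1)[OF f] this
  show "cat_comp (shuffle_algebra_cat K) X X Y f (cat_id (shuffle_algebra_cat K) X) = f"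
    unfolding shuffle_algebra_cat_def cat_data.simps
    by (rule ext) (rule compose_Id[OF fD(2,1)])
  show "cat_comp (shuffle_algebra_cat K) X Y Y (cat_id (shuffle_algebra_cat K) Y) f = f"
    unfolding shuffle_algebra_cat_def cat_data.simps
    by (rule ext) (rule Id_compose[OF fD(2,1)])
next
  fix W X Y Z f g h
  assume "f \<in> cat_hom (shuffle_algebra_cat K) W X"
  then have "f \<in> shuffle_algebra_hom K W X" by (simp add: shuffle_algebra_cat_def)
  then have f: "f n \<in> carrier (scomp W n) \<rightarrow> carrier (scomp X n)" for n
    using shuffle_algebra_homD(2) by (fastforce simp: linear_map_def)
  show "cat_comp (shuffle_algebra_cat K) W Y Z h (cat_comp (shuffle_algebra_cat K) W X Y g f) =
      cat_comp (shuffle_algebra_cat K) W X Z (cat_comp (shuffle_algebra_cat K) X Y Z h g) f"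
    unfolding shuffle_algebra_cat_def cat_data.simps
    by (rule ext) (rule compose_assoc[OF f])
qed

section \<open>The two functors\<close>

lemma labelled_prod_hom:
  assumes "shuffle_algebra K A" "f \<in> shuffle_algebra_hom K A B" "labelled A ps"
  shows "f (card (labels ps)) (labelled_prod A ps) =
    labelled_prod B (map (\<lambda>(S, x). (S, f (card S) x)) ps)"
  using assms(3)
proof (induction ps)
  case Nil
  then show ?case using shuffle_algebra_homD(3)[OF assms(2)] by simp
next
  case (Cons p ps)
  interpret shuffle_algebra K A by fact
  obtain S x where p: "p = (S, x)" by (cases p)
  have l: "finite S" "x \<in> carrier (scomp A (card S))" "S \<inter> labels ps = {}" "labelled A ps"
    "finite (labels ps)"
    using Cons.prems by (simp_all add: p finite_labels[of A])
  have "labels (map (\<lambda>(S, x). (S, f (card S) x)) ps) = labels ps"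
    by (induction ps) auto
  then show ?case
    using shuffle_algebra_homD(4)[OF assms(2) shuffle_sets_in_Sh[OF l(1,5,3)] l(2)
        labelled_prod_closed[OF l(4)]]
      Cons.IH[OF l(4)] card_Un_disjoint[OF l(1,5,3)]
    by (simp add: p set_prod_def)
qed

lemma shift_permutad_hom:
  assumes "permutad K P" "permutad K Q" "f \<in> permutad_hom K P Q"
  shows "(\<lambda>n. f (n + 1)) \<in> shuffle_algebra_hom K (shuffle_algebra_of K P) (shuffle_algebra_of K Q)"
proof -
  interpret P: permutad K P by fact
  interpret Q: permutad K Q by fact
  note fD = permutad_homD[OF assms(3)]
  have lin: "linear_map K (pcomp P (Suc n)) (pcomp Q (Suc n)) (f (Suc n))" for n by (rule fD) simp
  \<comment> \<open>A linear map that preserves the identity preserves coordinates. This settles the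
    products with a factor of degree 0.\<close>
  have coeff: "unit_coeff K Q (f (Suc 0) u) = unit_coeff K P u"
    if "u \<in> carrier (pcomp P (Suc 0))" for u
  proof -
    note c = P.unit_coeff_closed[OF that]
    have "f (Suc 0) (unit_coeff K P u \<odot>\<^bsub>pcomp P (Suc 0)\<^esub> pid P) =
        unit_coeff K P u \<odot>\<^bsub>pcomp Q (Suc 0)\<^esub> pid Q"
      using lin[of 0] c(1) P.id_closed fD(4) by (simp add: linear_map_def)
    then have "f (Suc 0) u = unit_coeff K P u \<odot>\<^bsub>pcomp Q (Suc 0)\<^esub> pid Q" by (simp only: c(2))
    then show ?thesis using Q.unit_coeff_smult_id c(1) by simp
  qed
  show ?thesis
  proof (rule shuffle_algebra_homI)
    fix n m \<gamma> x y
    assume \<gamma>: "\<gamma> \<in> Sh [n, m]" and "x \<in> carrier (scomp (shuffle_algebra_of K P) n)"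
      "y \<in> carrier (scomp (shuffle_algebra_of K P) m)"
    then have x: "x \<in> carrier (pcomp P (n + 1))" and y: "y \<in> carrier (pcomp P (m + 1))" by simp_all
    have fx: "f (n + 1) x \<in> carrier (pcomp Q (n + 1))"
      and fy: "f (m + 1) y \<in> carrier (pcomp Q (m + 1))"
      using linear_mapD[OF lin] x y by simp_all
    consider "n = 0" | "m = 0" | "n \<noteq> 0" "m \<noteq> 0" by blast
    then show "f (n + m + 1) (sprod (shuffle_algebra_of K P) n m \<gamma> x y) =
        sprod (shuffle_algebra_of K Q) n m \<gamma> (f (n + 1) x) (f (m + 1) y)"
    proof cases
      case 1
      then show ?thesis
        using lin[of m] coeff[of x] P.unit_coeff_closed(1)[of x] x y
        by (simp add: sprod_shuffle_algebra_of linear_map_def)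
    next
      case 2
      then show ?thesis
        using P.sprod_unit(2)[of x n y \<gamma>] Q.sprod_unit(2)[of "f (n + 1) x" n "f (m + 1) y" \<gamma>]
          lin[of n] coeff[of y] P.unit_coeff_closed(1)[of y] x y fx fy
        by (simp add: linear_map_def)
    next
      case 3
      have "[x, y] \<in> gamma_args P (n + m) 2 (shuffle_sur n m \<gamma>)"
        using x y unfolding gamma_args_two fibres_shuffle_sur[OF \<gamma>] by simp
      from fD(5)[OF _ shuffle_sur_in_Sur[OF \<gamma> 3] this] show ?thesis
        unfolding sprod_shuffle_algebra_of(3)[OF 3] input_arities_two fibres_shuffle_sur[OF \<gamma>]
        by simp
    qed
  qed (use fD lin in simp_all)
qed

lemma shift_shuffle_algebra_hom:
  assumes "shuffle_algebra K A" "f \<in> shuffle_algebra_hom K A B"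
  shows "(\<lambda>n\<in>{1..}. f (n - 1)) \<in> permutad_hom K (permutad_of A) (permutad_of B)"
proof (rule permutad_homI)
  interpret shuffle_algebra K A by fact
  let ?g = "\<lambda>n\<in>{1..}. f (n - 1)"
  fix n k t ls assume t: "t \<in> Sur n k" and ls: "ls \<in> gamma_args (permutad_of A) n k t"
  then have l: "list_all2 (\<lambda>x j. x \<in> carrier (scomp A (card (fibre n t j)))) ls [1..<Suc k]"
    by (simp add: gamma_args_iff del: upt_Suc)
  note lab = labelled_gamma_args[OF t l]
  \<comment> \<open>The arity of an input is one more than the size of its fibre, and
    \<open>?g\<close> takes this one off again.\<close>
  have "map (\<lambda>(S, x). (S, f (card S) x)) (zip (map (fibre n t) [1..<Suc k]) ls) =
      zip (map (fibre n t) [1..<Suc k]) (map2 ?g (input_arities n k t) ls)"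
    unfolding input_arities_def
    by (intro nth_equalityI) (auto simp del: upt_Suc)
  then show "?g (n + 1) (pgamma (permutad_of A) n k t ls) =
      pgamma (permutad_of B) n k t (map2 ?g (input_arities n k t) ls)"
    using labelled_prod_hom[OF assms lab(1)] unfolding lab(2) by (simp del: upt_Suc)
qed (use shuffle_algebra_homD[OF assms(2)] in simp_all)

definition to_shuffle_algebras ::
    "('k, 'r) ring_scheme \<Rightarrow> (('k, 'a) permutad_data, nat \<Rightarrow> 'a \<Rightarrow> 'a,
      ('k, 'a) shuffle_algebra_data, nat \<Rightarrow> 'a \<Rightarrow> 'a) functor_data" where
  "to_shuffle_algebras K = \<lparr>on_ob = shuffle_algebra_of K, on_hom = (\<lambda>P Q f n. f (n + 1))\<rparr>"

text \<open>The restriction to positive arities makes the shifted family extensional in the arity,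
  as \<open>permutad_hom\<close> demands; families of shuffle algebra morphisms are indexed by all
  degrees.\<close>

definition to_permutads ::
    "(('k, 'a) shuffle_algebra_data, nat \<Rightarrow> 'a \<Rightarrow> 'a,
      ('k, 'a) permutad_data, nat \<Rightarrow> 'a \<Rightarrow> 'a) functor_data" where
  "to_permutads = \<lparr>on_ob = permutad_of, on_hom = (\<lambda>A B g. \<lambda>n\<in>{1..}. g (n - 1))\<rparr>"

lemma cat_functor_to_shuffle_algebras:
  "cat_functor (permutad_cat K) (shuffle_algebra_cat K) (to_shuffle_algebras K)"
proof (intro cat_functor.intro cat_functor_axioms.intro category_permutad_cat
    category_shuffle_algebra_cat)
qed (auto simp: to_shuffle_algebras_def permutad_cat_def shuffle_algebra_cat_def
    permutad.shuffle_algebra_shuffle_algebra_of shift_permutad_hom[simplified])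

lemma cat_functor_to_permutads:
  "cat_functor (shuffle_algebra_cat K) (permutad_cat K) to_permutads"
proof (intro cat_functor.intro cat_functor_axioms.intro category_permutad_cat
    category_shuffle_algebra_cat)
qed (auto simp: to_permutads_def permutad_cat_def shuffle_algebra_cat_def
    shuffle_algebra.permutad_permutad_of shift_shuffle_algebra_hom[simplified] intro!: restrict_ext)

text \<open>By \<open>gamma_eq_labelled_prod\<close>, \<open>P\<close> and its round trip share
  components in positive arity and \<Gamma> on legitimate arguments, so the identity maps are
  morphisms in both directions between the two records.\<close>

lemma natural_iso_permutads:
  "natural_iso (permutad_cat K) (permutad_cat K) functor_id
     (functor_comp to_permutads (to_shuffle_algebras K)) (cat_id (permutad_cat K))"
proof -
  let ?C = "permutad_cat K" and ?GF = "\<lambda>P. permutad_of (shuffle_algebra_of K P)"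
  interpret C: category ?C by (rule category_permutad_cat)
  have id: "cat_id ?C (?GF P) = cat_id ?C P" for P by (auto simp: permutad_cat_def)
  have comp: "cat_comp ?C (?GF P) Y Z = cat_comp ?C P Y Z" for P Y Z
    by (auto simp: permutad_cat_def intro!: ext restrict_ext)
  \<comment> \<open>Composition looks only at the carriers of the source, so the objects in it can
    be exchanged freely.\<close>
  have comp': "cat_comp ?C X Y Z = cat_comp ?C X X X" for X Y Z
    by (simp add: permutad_cat_def)
  have args: "gamma_args (?GF P) = gamma_args P" for P
    by (intro ext) (simp add: gamma_args_def input_arities_def comp_def)
  have iso: "cat_iso ?C P (?GF P) (cat_id ?C P)" if P: "permutad K P" for P
  proof -
    interpret permutad K P by fact
    interpret A: shuffle_algebra K "shuffle_algebra_of K P"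
      by (rule shuffle_algebra_shuffle_algebra_of)
    have gamma: "pgamma (?GF P) n k t ls = pgamma P n k t ls"
      if "1 \<le> k" "t \<in> Sur n k" "ls \<in> gamma_args P n k t" for n k t ls
      using gamma_eq_labelled_prod[OF that] by (simp del: upt_Suc)
    have 1: "cat_id ?C P \<in> permutad_hom K P (?GF P)"
      using restrict_id_in_permutad_hom[OF P, of "?GF P"] gamma by (simp add: permutad_cat_def)
    have "cat_id ?C (?GF P) \<in> permutad_hom K (?GF P) P"
      using restrict_id_in_permutad_hom[OF A.permutad_permutad_of, of P] gamma
      by (simp add: permutad_cat_def args)
    then have 2: "cat_id ?C P \<in> permutad_hom K (?GF P) P" by (simp only: id)
    have "cat_comp ?C P P P (cat_id ?C P) (cat_id ?C P) = cat_id ?C P"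
      using C.id_in_hom P by (intro C.comp_id_left) (auto simp: permutad_cat_def)
    then show ?thesis
      unfolding cat_iso_def using 1 2 comp[of P] comp'[of P] id[of P]
      by (auto simp: permutad_cat_def intro!: bexI[of _ "cat_id ?C P"])
  qed
  have nat: "cat_comp ?C P Q (?GF Q) (cat_id ?C Q) f = cat_comp ?C P (?GF P) (?GF Q) f (cat_id ?C P)"
    if "P \<in> cat_ob ?C" "Q \<in> cat_ob ?C" "f \<in> cat_hom ?C P Q" for P Q f
    using C.comp_id_left[OF that] C.comp_id_right[OF that] comp'[of P] by metis
  \<comment> \<open>Shifting the index down and up is harmless at positive arities; at arity 0 both
    sides are \<open>undefined\<close>.\<close>
  have hom: "(\<lambda>n\<in>{1..}. f (n - 1 + 1)) = f" if "f \<in> cat_hom ?C P Q" for P Q f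
  proof -
    have "f \<in> extensional {1..}" using that permutad_homD(1) by (auto simp: permutad_cat_def)
    then show ?thesis by (intro extensionalityI[of _ "{1..}"]) auto
  qed
  have ob: "cat_ob ?C = {P. permutad K P}" by (simp add: permutad_cat_def)
  show ?thesis
    unfolding natural_iso_def functor_id_def functor_comp_def to_permutads_def
      to_shuffle_algebras_def functor_data.simps
    by (intro conjI ballI) (simp_all only: hom nat, simp_all only: iso ob mem_Collect_eq)
qed

text \<open>Here the components agree in every degree, and by
  \<open>sprod_shuffle_algebra_of_permutad_of\<close> the products agree on shuffles and carrier
  elements; again the identity maps serve.\<close>

lemma natural_iso_shuffle_algebras:
  "natural_iso (shuffle_algebra_cat K) (shuffle_algebra_cat K)
     (functor_comp (to_shuffle_algebras K) to_permutads) functor_id (cat_id (shuffle_algebra_cat K))"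
proof -
  let ?C = "shuffle_algebra_cat K" and ?FG = "\<lambda>A. shuffle_algebra_of K (permutad_of A)"
  interpret C: category ?C by (rule category_shuffle_algebra_cat)
  have id: "cat_id ?C (?FG A) = cat_id ?C A" for A by (simp add: shuffle_algebra_cat_def)
  have comp: "cat_comp ?C (?FG A) Y Z = cat_comp ?C A Y Z" for A Y Z
    by (simp add: shuffle_algebra_cat_def)
  have comp': "cat_comp ?C X Y Z = cat_comp ?C X X X" for X Y Z
    by (simp add: shuffle_algebra_cat_def)
  have iso: "cat_iso ?C (?FG A) A (cat_id ?C A)" if A: "shuffle_algebra K A" for A
  proof -
    interpret shuffle_algebra K A by fact
    interpret P: permutad K "permutad_of A" by (rule permutad_permutad_of)
    note prod = sprod_shuffle_algebra_of_permutad_of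
    have 1: "cat_id ?C A \<in> shuffle_algebra_hom K A (?FG A)"
      using restrict_id_in_shuffle_algebra_hom[OF A, of "?FG A"] prod
      by (simp add: shuffle_algebra_cat_def)
    have "cat_id ?C (?FG A) \<in> shuffle_algebra_hom K (?FG A) A"
      using restrict_id_in_shuffle_algebra_hom[OF P.shuffle_algebra_shuffle_algebra_of, of A] prod
      by (simp add: shuffle_algebra_cat_def)
    then have 2: "cat_id ?C A \<in> shuffle_algebra_hom K (?FG A) A" by (simp only: id)
    have "cat_comp ?C A A A (cat_id ?C A) (cat_id ?C A) = cat_id ?C A"
      using C.id_in_hom A by (intro C.comp_id_left) (auto simp: shuffle_algebra_cat_def)
    then show ?thesis
      unfolding cat_iso_def using 1 2 comp[of A] comp'[of A] id[of A]
      by (auto simp: shuffle_algebra_cat_def intro!: bexI[of _ "cat_id ?C A"])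
  qed
  have nat: "cat_comp ?C (?FG A) (?FG B) B (cat_id ?C B) f = cat_comp ?C (?FG A) A B f (cat_id ?C A)"
    if "A \<in> cat_ob ?C" "B \<in> cat_ob ?C" "f \<in> cat_hom ?C A B" for A B f
    unfolding comp using C.comp_id_left[OF that] C.comp_id_right[OF that] comp'[of A] by metis
  show ?thesis
    unfolding natural_iso_def functor_id_def functor_comp_def to_permutads_def
      to_shuffle_algebras_def functor_data.simps
    using iso nat by (auto simp: shuffle_algebra_cat_def)
qed

text \<open>Morphisms are shifted like the components. The clause for \<open>G\<close> is stated at
  \<open>n + 1\<close> because permutad morphisms take the value \<open>undefined\<close> at arity
  0.\<close>

theorem proposition3p5:
  fixes K :: "('k, 'r) ring_scheme"
  assumes "cring K"
  shows "\<exists>(F :: (('k, 'a) permutad_data, nat \<Rightarrow> 'a \<Rightarrow> 'a,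
                  ('k, 'a) shuffle_algebra_data, nat \<Rightarrow> 'a \<Rightarrow> 'a) functor_data)
            (G :: (('k, 'a) shuffle_algebra_data, nat \<Rightarrow> 'a \<Rightarrow> 'a,
                  ('k, 'a) permutad_data, nat \<Rightarrow> 'a \<Rightarrow> 'a) functor_data).
    cat_equivalence (permutad_cat K) (shuffle_algebra_cat K) F G \<and>
    (\<forall>P. permutad K P \<longrightarrow> identified P (on_ob F P)) \<and>
    (\<forall>A. shuffle_algebra K A \<longrightarrow> identified (on_ob G A) A) \<and>
    (\<forall>P Q f. permutad K P \<longrightarrow> permutad K Q \<longrightarrow> f \<in> permutad_hom K P Q \<longrightarrow>
       (\<forall>n. on_hom F P Q f n = f (n + 1))) \<and>
    (\<forall>A B g. shuffle_algebra K A \<longrightarrow> shuffle_algebra K B \<longrightarrow> g \<in> shuffle_algebra_hom K A B \<longrightarrow>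
       (\<forall>n. on_hom G A B g (n + 1) = g n))"
proof (intro exI conjI)
  show "cat_equivalence (permutad_cat K) (shuffle_algebra_cat K) (to_shuffle_algebras K) to_permutads"
    unfolding cat_equivalence_def
    using cat_functor_to_shuffle_algebras cat_functor_to_permutads natural_iso_permutads
      natural_iso_shuffle_algebras by blast
qed (auto simp: to_shuffle_algebras_def to_permutads_def permutad.identified_shuffle_algebra_of
    shuffle_algebra.identified_permutad_of)

end
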